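(* Let $s\in(0,1)$, $N\ge2$, $\sigma\equiv0$, let $x_1^0<\dots<x_N^0$, and let $\zeta_1,\dots,\zeta_N\in\{-1,1\}$ satisfy $$\zeta_i\zeta_{i+1}=-1\qquad\text{for any } i=1,\dots,N-1 .$$ Then, for the particle system described in the context, a collision occurs in a finite time $T_c$, with $$T_c\le\frac{(N-1)\,(x_N^0-x_1^0)^{2s+1}}{(2s+1)\gamma}\quad\text{if }N\text{ is odd},$$ and $$T_c\le\frac{s\,(x_N^0-x_1^0)^{2s+1}}{(2s+1)\gamma}\quad\text{if }N\text{ is even}.$$
   Context: Operator: for $s\in(0,1)$ and $\varphi\in C^2(\mathbb R)\cap L^\infty(\mathbb R)$, $\mathcal I_s[\varphi](x):=PV\int_{\mathbb R}\frac{\varphi(x+y)-\varphi(x)}{|y|^{1+2s}}\,dy$. $W$ satisfies: $W\in C^{3,\alpha}(\mathbb R)$ for some $0<\alpha<1$; $W(v+1)=W(v)$ for all $v\in\mathbb R$; $W=0$ on $\mathbb Z$; $W>0$ on $\mathbb R\setminus\mathbb Z$; $W''(0)>0$. Layer solution: $u$ is the unique solution of $\mathcal I_s(u)=W'(u)$ in $\mathbb R$, $u'>0$ in $\mathbb R$, $\lim_{x\to-\infty}u(x)=0$, $\lim_{x\to+\infty}u(x)=1$, $u(0)=\tfrac12$ (its existence and uniqueness are known). Set $\gamma:=\left(\int_{\mathbb R}(u'(x))^2dx\right)^{-1}>0$. Particle system (with $\sigma\equiv0$): $(x_i(t))_{i=1,\dots,N}$ solves $$\dot x_i=\gamma\sum_{j\ne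 i}\zeta_i\zeta_j\frac{x_i-x_j}{2s|x_i-x_j|^{1+2s}}\ \text{ in }(0,T_c),\qquad x_i(0)=x_i^0,$$ where $(0,T_c)$, $0<T_c\le+\infty$, is the maximal interval on which the system is well defined, i.e. on which $x_i\ne x_j$ for all $i\ne j$; thus $T_c$ is the first collision time. *)

theory Defs
  imports "HOL-Analysis.Analysis"
begin

definition C2 :: "(real \<Rightarrow> real) \<Rightarrow> bool" where
  "C2 f \<longleftrightarrow> (\<forall>x. f differentiable (at x)) \<and> (\<forall>x. deriv f differentiable (at x))
      \<and> continuous_on UNIV (deriv (deriv f))"

(* The Hoelder space on the whole line: derivatives up to order k exist and are bounded, and the
   k-th one is globally Hoelder continuous (hence continuous) with exponent \<alpha>. *)
definition Hoelder_class :: "nat \<Rightarrow> real \<Rightarrow> (real \<Rightarrow> real) \<Rightarrow> bool" where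
  "Hoelder_class k \<alpha> f \<longleftrightarrow>
     (\<forall>j<k. \<forall>x. (deriv ^^ j) f differentiable (at x)) \<and>
     (\<forall>j\<le>k. bounded (range ((deriv ^^ j) f))) \<and>
     (\<exists>C. \<forall>x y. \<bar>(deriv ^^ k) f x - (deriv ^^ k) f y\<bar> \<le> C * \<bar>x - y\<bar> powr \<alpha>)"

definition multiwell_potential :: "real \<Rightarrow> (real \<Rightarrow> real) \<Rightarrow> bool" where
  "multiwell_potential \<alpha> W \<longleftrightarrow>
     Hoelder_class 3 \<alpha> W \<and>
     (\<forall>v. W (v + 1) = W v) \<and>
     (\<forall>v\<in>\<int>. W v = 0) \<and>
     (\<forall>v. v \<notin> \<int> \<longrightarrow> W v > 0) \<and>
     deriv (deriv W) 0 > 0"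

(* I_s[\<phi>](x) exists as a principal value and equals L. For bounded continuous \<phi> and \<epsilon> > 0 the
   truncated integrand is integrable. *)
definition has_I :: "real \<Rightarrow> (real \<Rightarrow> real) \<Rightarrow> real \<Rightarrow> real \<Rightarrow> bool" where
  "has_I s \<phi> x L \<longleftrightarrow>
     ((\<lambda>\<epsilon>. LBINT y:{y. \<epsilon> < \<bar>y\<bar>}. (\<phi> (x + y) - \<phi> x) / \<bar>y\<bar> powr (1 + 2 * s)) \<longlongrightarrow> L) (at_right 0)"

definition layer_solution :: "real \<Rightarrow> (real \<Rightarrow> real) \<Rightarrow> (real \<Rightarrow> real) \<Rightarrow> bool" where
  "layer_solution s W u \<longleftrightarrow>
     C2 u \<and> bounded (range u) \<and>
     (\<forall>x. has_I s u x (deriv W (u x))) \<and>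
     (\<forall>x. deriv u x > 0) \<and>
     (u \<longlongrightarrow> 0) at_bot \<and> (u \<longlongrightarrow> 1) at_top \<and>
     u 0 = 1 / 2"

definition layer_gamma :: "(real \<Rightarrow> real) \<Rightarrow> real" where
  "layer_gamma u = inverse (LINT x|lborel. (deriv u x)\<^sup>2)"

(* Particles are indexed by {1..N}; x i t is the position of particle i at time t.
   The system is considered without external stress. *)
definition particle_velocity ::
  "real \<Rightarrow> real \<Rightarrow> nat \<Rightarrow> (nat \<Rightarrow> real) \<Rightarrow> (nat \<Rightarrow> real) \<Rightarrow> nat \<Rightarrow> real" where
  "particle_velocity s \<gamma> N \<zeta> p i =
     \<gamma> * (\<Sum>j\<in>{1..N} - {i}. \<zeta> i * \<zeta> j * ((p i - p j) / (2 * s * \<bar>p i - p j\<bar> powr (1 + 2 * s))))"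

definition particle_solution ::
  "real \<Rightarrow> real \<Rightarrow> nat \<Rightarrow> (nat \<Rightarrow> real) \<Rightarrow> (nat \<Rightarrow> real) \<Rightarrow> ereal \<Rightarrow> (nat \<Rightarrow> real \<Rightarrow> real) \<Rightarrow> bool" where
  "particle_solution s \<gamma> N \<zeta> x0 T x \<longleftrightarrow>
     0 < T \<and>
     (\<forall>i\<in>{1..N}. x i 0 = x0 i \<and> continuous_on {t. 0 \<le> t \<and> ereal t < T} (x i)) \<and>
     (\<forall>t. 0 \<le> t \<and> ereal t < T \<longrightarrow> (\<forall>i\<in>{1..N}. \<forall>j\<in>{1..N}. i \<noteq> j \<longrightarrow> x i t \<noteq> x j t)) \<and>
     (\<forall>t. 0 < t \<and> ereal t < T \<longrightarrow>
        (\<forall>i\<in>{1..N}. (x i has_real_derivative particle_velocity s \<gamma> N \<zeta> (\<lambda>j. x j t) i) (at t)))"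

(* (0,T) is the maximal interval of existence of a solution without collisions. *)
definition maximal_particle_solution ::
  "real \<Rightarrow> real \<Rightarrow> nat \<Rightarrow> (nat \<Rightarrow> real) \<Rightarrow> (nat \<Rightarrow> real) \<Rightarrow> ereal \<Rightarrow> (nat \<Rightarrow> real \<Rightarrow> real) \<Rightarrow> bool" where
  "maximal_particle_solution s \<gamma> N \<zeta> x0 T x \<longleftrightarrow>
     particle_solution s \<gamma> N \<zeta> x0 T x \<and>
     \<not> (\<exists>T' y. T < T' \<and> particle_solution s \<gamma> N \<zeta> x0 T' y \<and>
           (\<forall>i\<in>{1..N}. \<forall>t. 0 \<le> t \<and> ereal t < T \<longrightarrow> y i t = x i t))"

(* Only the values of x before time T matter, so the positions at time T are left limits. *)
definition collision_at :: "nat \<Rightarrow> (nat \<Rightarrow> real \<Rightarrow> real) \<Rightarrow> real \<Rightarrow> bool" where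
  "collision_at N x T \<longleftrightarrow>
     (\<exists>i\<in>{1..N}. \<exists>j\<in>{1..N}. i \<noteq> j \<and>
        (\<exists>p. (x i \<longlongrightarrow> p) (at_left T) \<and> (x j \<longlongrightarrow> p) (at_left T)))"

end

(*
Positivity of gamma amounts to u' being square integrable. The increment v(x) = u(x+h) - u(x)
attains its maximum m, has mass at most h on every interval, and I_s v is a difference of two
values of W'(u). Since v has mass at most h, I_s v at the maximum is at most -h (m/(4h))^(1+2s),
while it is at least -C m because W' is Lipschitz. Hence m <= K h with K independent of h, so u'
is bounded, and u'^2 <= K u' is integrable.

For alternating charges, pairing the terms of the force on an outer particle shows that the width
D = x_N - x_1 satisfies D' <= -(gamma/s) D^(-2s) for even N and D' <= -gamma D^(-2s) for odd N, so
D^(2s+1) would become negative after the stated time. At the maximal time T all particles have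
limits: convexity of the repulsion r^(-2s)/(2s) makes every partial sum x_1 + ... + x_k
nondecreasing, and these sums are bounded. If the limits were distinct, the solution could be
continued past T by Picard's theorem.
*)
theory Submission
  imports Defs
begin

section \<open>Regularity of the layer solution\<close>

text \<open>\<open>layer_gamma\<close> inverts a Bochner integral, which is 0 by convention when
  u'^2 is not integrable; its inverse would then be 0 as well and no particle would move.
  \<open>layer_solution\<close> contains no bound on u', so the bound has to come from the equation.
  Increments replace u' because they are bounded, continuous and vanish at both ends, hence attain a
  maximum, and because their equation arises by subtraction, without differentiating a principal
  value. For the particles the obstacle is the behaviour at T: velocities may be unbounded near a
  collision, so no estimate on a single equation yields limits, while \<open>collision_at\<close>
  asks for a common limit and maximality alone supplies none. Partial sums work because the forces
  inside the block of the first k particles cancel, and for alternating charges the remaining forces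
  across the cut pull this block to the right as a whole.\<close>

lemma integrable_powr_tail:
  fixes \<epsilon> e :: real
  assumes "0 < \<epsilon>" "e < -1"
  shows "set_integrable lborel {y. \<epsilon> < \<bar>y\<bar>} (\<lambda>y. \<bar>y\<bar> powr e)"
proof -
  have "(\<lambda>y::real. y powr e) integrable_on {\<epsilon>..}"
    using has_integral_powr_to_inf[OF assms(2,1)] by blast
  then have "(\<lambda>y::real. y powr e) absolutely_integrable_on {\<epsilon>..}"
    by (intro nonnegative_absolutely_integrable_1) auto
  then have *: "integrable lborel (\<lambda>y. indicator {\<epsilon>..} y *\<^sub>R (y powr e))"
    unfolding set_integrable_def by (subst (asm) integrable_completion) auto
  have "integrable lborel (\<lambda>y. indicator {\<epsilon>..} (-y) *\<^sub>R ((-y) powr e))"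
    using lborel_integrable_real_affine[OF *, of "-1" 0] by simp
  with * have sum: "integrable lborel
      (\<lambda>y. indicator {\<epsilon>..} y *\<^sub>R (y powr e) + indicator {\<epsilon>..} (-y) *\<^sub>R ((-y) powr e))"
    by (rule Bochner_Integration.integrable_add)
  show ?thesis
    unfolding set_integrable_def
    by (rule Bochner_Integration.integrable_bound[OF sum])
      (use assms in \<open>auto simp: indicator_def abs_if intro!: AE_I2\<close>)
qed

section \<open>A bound on the increments of the layer from its nonlocal equation\<close>

text \<open>Away from 0 the numerator is at most 2B and the kernel decays like |y|^-(1+2s).
  Integrability is what allows truncated integrals to be subtracted and compared.\<close>

lemma integrable_truncated_kernel:
  fixes \<phi> :: "real \<Rightarrow> real"
  assumes "0 < s" "0 < \<epsilon>" and "continuous_on UNIV \<phi>" and "\<And>x. \<bar>\<phi> x\<bar> \<le> B"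
  shows "set_integrable lborel {y. \<epsilon> < \<bar>y\<bar>} (\<lambda>y. (\<phi> (x + y) - \<phi> x) / \<bar>y\<bar> powr (1 + 2 * s))"
proof -
  have [measurable]: "\<phi> \<in> borel_measurable borel"
    using assms(3) by (rule borel_measurable_continuous_onI)
  have "set_integrable lborel {y. \<epsilon> < \<bar>y\<bar>} (\<lambda>y. \<bar>y\<bar> powr (- (1 + 2 * s)))"
    by (rule integrable_powr_tail) (use assms in auto)
  then have "set_integrable lborel {y. \<epsilon> < \<bar>y\<bar>} (\<lambda>y. (2 * B) * inverse (\<bar>y\<bar> powr (1 + 2 * s)))"
    unfolding powr_minus
    by (rule set_integrable_mult_right) 
  then show ?thesis
    unfolding set_integrable_def
  proof (rule Bochner_Integration.integrable_bound)
    have "\<bar>\<phi> (x + y) - \<phi> x\<bar> \<le> \<bar>2 * B\<bar>" for y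
      using assms(4)[of "x + y"] assms(4)[of x] by linarith
    then show "AE y in lborel.
        norm (indicator {y. \<epsilon> < \<bar>y\<bar>} y *\<^sub>R ((\<phi> (x + y) - \<phi> x) / \<bar>y\<bar> powr (1 + 2 * s)))
        \<le> norm (indicator {y. \<epsilon> < \<bar>y\<bar>} y *\<^sub>R (2 * B * inverse (\<bar>y\<bar> powr (1 + 2 * s))))"
      by (intro AE_I2) (auto simp: indicator_def powr_minus divide_inverse abs_mult intro!: mult_right_mono)
  qed measurable
qed

text \<open>The truncated operator commutes with translations, so for every fixed \<epsilon> the two
  integrals subtract; only then is the limit taken.\<close>

lemma has_I_shift_diff:
  fixes \<phi> :: "real \<Rightarrow> real"
  assumes "0 < s" and "continuous_on UNIV \<phi>" and "\<And>x. \<bar>\<phi> x\<bar> \<le> B"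
    and "has_I s \<phi> (x + h) L" and "has_I s \<phi> x M"
  shows "has_I s (\<lambda>z. \<phi> (z + h) - \<phi> z) x (L - M)"
proof -
  have eq: "(LBINT y:{y. \<epsilon> < \<bar>y\<bar>}. (\<phi> (x + h + y) - \<phi> (x + h)) / \<bar>y\<bar> powr (1 + 2 * s))
      - (LBINT y:{y. \<epsilon> < \<bar>y\<bar>}. (\<phi> (x + y) - \<phi> x) / \<bar>y\<bar> powr (1 + 2 * s))
    = (LBINT y:{y. \<epsilon> < \<bar>y\<bar>}. (\<phi> (x + y + h) - \<phi> (x + y) - (\<phi> (x + h) - \<phi> x)) / \<bar>y\<bar> powr (1 + 2 * s))"
    if "0 < \<epsilon>" for \<epsilon>
    unfolding set_integral_diff(2)[OF integrable_truncated_kernel[OF assms(1) that assms(2,3)]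
        integrable_truncated_kernel[OF assms(1) that assms(2,3)], symmetric]
    by (simp add: diff_divide_distrib[symmetric] algebra_simps)
  have "((\<lambda>\<epsilon>. (LBINT y:{y. \<epsilon> < \<bar>y\<bar>}. (\<phi> (x + h + y) - \<phi> (x + h)) / \<bar>y\<bar> powr (1 + 2 * s))
      - (LBINT y:{y. \<epsilon> < \<bar>y\<bar>}. (\<phi> (x + y) - \<phi> x) / \<bar>y\<bar> powr (1 + 2 * s))) \<longlongrightarrow> L - M) (at_right 0)"
    using assms(4,5) unfolding has_I_def by (rule tendsto_diff)
  then show ?thesis
    unfolding has_I_def
    by (rule Lim_transform_eventually) (auto simp: eq eventually_at_right_less intro: eventually_mono[OF eventually_at_right_less])
qed

text \<open>At a maximum the integrand is nonpositive, so everything outside the shell \<delta>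
  \<le> y \<le> 2\<delta> may be dropped. With \<delta> = 2h/m the constant m has mass 2h on the
  shell and v has mass at most h there, so m - v keeps mass at least h, while the kernel is at least
  (2\<delta>)^-(1+2s) = (m/(4h))^(1+2s).\<close>

lemma has_I_le_at_max:
  fixes v :: "real \<Rightarrow> real"
  assumes "0 < s" and cont: "continuous_on UNIV v" and bd: "\<And>x. \<bar>v x\<bar> \<le> B"
    and max: "\<And>y. v y \<le> v x" and I: "has_I s v x L"
    and "0 < h" and m: "v x > 0"
    and mass: "\<And>a b. a \<le> b \<Longrightarrow> (LINT y|lborel. v y * indicator {a..b} y) \<le> h"
  shows "L \<le> - h * (v x / (4 * h)) powr (1 + 2 * s)"
proof -
  define m where "m = v x"
  define \<delta> where "\<delta> = 2 * h / m"
  have "\<delta> > 0" "m > 0" using assms by (auto simp: \<delta>_def m_def)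
  define c where "c = (2 * \<delta>) powr - (1 + 2 * s)"
  have "c > 0" using \<open>\<delta> > 0\<close> by (simp add: c_def)
  have J: "v (x + y) * indicator {\<delta>..2 * \<delta>} y = v (x + y) * indicator {x + \<delta>..x + 2 * \<delta>} (x + y)" for y
    by (auto simp: indicator_def)
  have int: "integrable lborel (\<lambda>y. v (x + y) * indicator {\<delta>..2 * \<delta>} y)"
  proof (rule borel_integrable_atLeastAtMost)
    have *: "isCont v (x + y)" for y
      using cont by (simp add: continuous_on_eq_continuous_at)
    show "isCont (\<lambda>y. v (x + y)) y" for y
      by (rule isCont_o2[where f = "\<lambda>y. x + y" and g = v, OF _ *]) (intro continuous_intros)
  qed
  have mass': "(LINT y|lborel. v (x + y) * indicator {\<delta>..2 * \<delta>} y) \<le> h"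
    using lborel_integral_real_affine[of 1 "\<lambda>y. v y * indicator {x + \<delta>..x + 2 * \<delta>} y" x]
      mass[of "x + \<delta>" "x + 2 * \<delta>"] \<open>\<delta> > 0\<close> by (simp add: J)
  have const: "has_bochner_integral lborel (\<lambda>y. m * indicator {\<delta>..2 * \<delta>} y) (m * \<delta>)"
  proof -
    have "has_bochner_integral lborel (indicator {\<delta>..2 * \<delta>}) (measure lborel {\<delta>..2 * \<delta>} :: real)"
      by (rule has_bochner_integral_real_indicator) (use \<open>\<delta> > 0\<close> in auto)
    from has_bochner_integral_mult_right[OF this, of m] show ?thesis
      using \<open>\<delta> > 0\<close> by simp
  qed
  have intc: "integrable lborel (\<lambda>y. c * (v (x + y) * indicator {\<delta>..2 * \<delta>} y - m * indicator {\<delta>..2 * \<delta>} y))"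
    by (intro integrable_mult_right Bochner_Integration.integrable_diff int integrable.intros[OF const]) 
  have "(LINT y|lborel. c * (v (x + y) * indicator {\<delta>..2 * \<delta>} y - m * indicator {\<delta>..2 * \<delta>} y))
      = c * ((LINT y|lborel. v (x + y) * indicator {\<delta>..2 * \<delta>} y) - m * \<delta>)"
    using int const by (simp add: has_bochner_integral_iff)
  also have "\<dots> \<le> c * (h - m * \<delta>)"
    using mass' \<open>c > 0\<close> by simp
  also have "\<dots> = - h * c"
    using \<open>m > 0\<close> by (simp add: \<delta>_def)
  also have "- h * c = - h * (m / (4 * h)) powr (1 + 2 * s)"
    unfolding c_def powr_minus by (simp add: \<delta>_def powr_divide)
  finally have upper: "(LINT y|lborel. c * (v (x + y) * indicator {\<delta>..2 * \<delta>} y - m * indicator {\<delta>..2 * \<delta>} y))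
      \<le> - h * (m / (4 * h)) powr (1 + 2 * s)" .
  \<comment> \<open>For \<epsilon> < \<delta> the truncation does not touch the shell, so the bound
    is the same for all these \<epsilon> and survives the limit.\<close>
  have "(LBINT y:{y. \<epsilon> < \<bar>y\<bar>}. (v (x + y) - v x) / \<bar>y\<bar> powr (1 + 2 * s))
      \<le> - h * (m / (4 * h)) powr (1 + 2 * s)" if "0 < \<epsilon>" "\<epsilon> < \<delta>" for \<epsilon>
  proof -
    have "(LBINT y:{y. \<epsilon> < \<bar>y\<bar>}. (v (x + y) - v x) / \<bar>y\<bar> powr (1 + 2 * s))
      \<le> (LINT y|lborel. c * (v (x + y) * indicator {\<delta>..2 * \<delta>} y - m * indicator {\<delta>..2 * \<delta>} y))"
      unfolding set_lebesgue_integral_def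
    proof (rule integral_mono)
      fix y :: real
      show "indicator {y. \<epsilon> < \<bar>y\<bar>} y *\<^sub>R ((v (x + y) - v x) / \<bar>y\<bar> powr (1 + 2 * s))
          \<le> c * (v (x + y) * indicator {\<delta>..2 * \<delta>} y - m * indicator {\<delta>..2 * \<delta>} y)"
      proof (cases "y \<in> {\<delta>..2 * \<delta>}")
        case True
        then have "c \<le> inverse (\<bar>y\<bar> powr (1 + 2 * s))"
          unfolding c_def powr_minus[symmetric] using \<open>0 < s\<close> \<open>\<delta> > 0\<close> by (intro powr_mono2') auto
        then have "(m - v (x + y)) * c \<le> (m - v (x + y)) * inverse (\<bar>y\<bar> powr (1 + 2 * s))"
          using max by (intro mult_left_mono) (auto simp: m_def)
        then show ?thesis
          using True that by (simp add: m_def[symmetric] divide_inverse algebra_simps)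
      next
        case False
        then show ?thesis
          using max[of "x + y"] by (auto simp: indicator_def intro!: divide_nonpos_nonneg)
      qed
    qed (use integrable_truncated_kernel[OF assms(1) \<open>0 < \<epsilon>\<close> cont bd] intc in
        \<open>auto simp: set_integrable_def\<close>)
    with upper show ?thesis by linarith
  qed
  then have "eventually (\<lambda>\<epsilon>. (LBINT y:{y. \<epsilon> < \<bar>y\<bar>}. (v (x + y) - v x) / \<bar>y\<bar> powr (1 + 2 * s))
      \<le> - h * (m / (4 * h)) powr (1 + 2 * s)) (at_right 0)"
    using \<open>\<delta> > 0\<close> unfolding eventually_at_right_field by blast
  with I show ?thesis
    unfolding has_I_def m_def by (intro tendsto_upperbound[where F = "at_right 0"]) auto
qed

lemma attains_max_of_vanishing:
  fixes v :: "real \<Rightarrow> real"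
  assumes "continuous_on UNIV v" and "v z > 0" and "(v \<longlongrightarrow> 0) at_top" "(v \<longlongrightarrow> 0) at_bot"
  obtains x where "\<And>y. v y \<le> v x"
proof -
  from assms(2,3) have "eventually (\<lambda>x. v x < v z) at_top" by (simp add: order_tendstoD)
  then obtain b where b: "\<And>x. b \<le> x \<Longrightarrow> v x < v z" by (auto simp: eventually_at_top_linorder)
  from assms(2,4) have "eventually (\<lambda>x. v x < v z) at_bot" by (simp add: order_tendstoD)
  then obtain a where a: "\<And>x. x \<le> a \<Longrightarrow> v x < v z" by (auto simp: eventually_at_bot_linorder)
  have z: "z \<in> {a..b}" using a[of z] b[of z] by force
  then obtain x where x: "\<And>y. y \<in> {a..b} \<Longrightarrow> v y \<le> v x"
    using continuous_attains_sup[of "{a..b}" v] continuous_on_subset[OF assms(1), of "{a..b}"] by blast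
  have "v y \<le> v x" for y
    using a[of y] b[of y] x[OF z] x[of y] by (cases "y \<in> {a..b}") (auto simp: not_le)
  then show thesis by (rule that)
qed

text \<open>The integral telescopes to the mass of u on [b, b + h] minus its mass on [a, a + h]; the
  former is at most h and the latter is nonnegative because u takes values in [0, 1].\<close>

lemma integral_increment_le:
  fixes u :: "real \<Rightarrow> real"
  assumes cont: "continuous_on UNIV u" and "\<And>x. 0 \<le> u x" "\<And>x. u x \<le> 1" and "0 \<le> h" "a \<le> b"
  shows "(LINT y|lborel. (u (y + h) - u y) * indicator {a..b} y) \<le> h"
proof -
  \<comment> \<open>The margin of 1 on both sides makes the derivative of the antiderivative
    two-sided on all of [a, b + h].\<close>
  obtain U where U: "\<And>x. x \<in> {a - 1..b + h + 1} \<Longrightarrow> (U has_vector_derivative u x) (at x within {a - 1..b + h + 1})"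
    using antiderivative_continuous[OF continuous_on_subset[OF cont]] by blast
  have D: "(U has_real_derivative u x) (at x)" if "a \<le> x" "x \<le> b + h" for x
    using U[of x] that at_within_Icc_at[of "a - 1" x "b + h + 1"]
    by (simp add: has_real_derivative_iff_has_vector_derivative)
  have "(LINT y|lborel. (u (y + h) - u y) * indicator {a..b} y) = (U (b + h) - U b) - (U (a + h) - U a)"
  proof (subst integral_FTC_Icc_real[where F = "\<lambda>y. U (y + h) - U y"])
    fix y assume "a \<le> y" "y \<le> b"
    then show "((\<lambda>y. U (y + h) - U y) has_real_derivative u (y + h) - u y) (at y)"
      using \<open>0 \<le> h\<close> by (intro DERIV_diff D DERIV_shift[THEN iffD1]) auto
    show "isCont (\<lambda>y. u (y + h) - u y) y"
      using cont by (intro continuous_intros isCont_o2[where f = "\<lambda>y. y + h"])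
        (auto simp: continuous_on_eq_continuous_at)
  qed (use assms in auto)
  moreover have "U (a + h) - U a \<ge> 0"
    unfolding diff_ge_0_iff_ge
    by (rule DERIV_nonneg_imp_nondecreasing[where f = U]) (use assms in \<open>auto intro!: exI D\<close>)
  moreover have "U (b + h) - (b + h) \<le> U b - b"
  proof (rule DERIV_nonpos_imp_nonincreasing[where f = "\<lambda>x. U x - x"])
    fix x assume "b \<le> x" "x \<le> b + h"
    then have "((\<lambda>x. U x - x) has_real_derivative u x - 1) (at x)"
      using \<open>a \<le> b\<close> by (intro DERIV_diff D DERIV_ident) auto
    then show "\<exists>y. ((\<lambda>x. U x - x) has_real_derivative y) (at x) \<and> y \<le> 0"
      using assms(3)[of x] by force
  qed (use assms in auto)
  ultimately show ?thesis by linarith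
qed

text \<open>Here \<open>g\<close> stands for W'. With r = v z / (4h) at the maximum z, the upper
  bound on I_s v and the Lipschitz bound give h r^(1+2s) \<le> 4 C h r. The factor h r cancels,
  which leaves r^(2s) \<le> 4C without h, so the estimate passes to difference quotients.\<close>

lemma increment_le_of_has_I:
  fixes u g :: "real \<Rightarrow> real"
  assumes "0 < s" and cont: "continuous_on UNIV u"
    and mono: "\<And>x y. x < y \<Longrightarrow> u x < u y"
    and lim: "(u \<longlongrightarrow> 0) at_bot" "(u \<longlongrightarrow> 1) at_top"
    and u01: "\<And>x. 0 \<le> u x" "\<And>x. u x \<le> 1"
    and I: "\<And>x. has_I s u x (g (u x))"
    and lip: "\<And>a b. \<bar>g a - g b\<bar> \<le> C * \<bar>a - b\<bar>"
    and "0 < h"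
  shows "u (x + h) - u x \<le> 4 * h * (4 * C) powr (1 / (2 * s))"
proof -
  define v where "v y = u (y + h) - u y" for y
  have v_pos: "v y > 0" for y using mono[of y "y + h"] \<open>0 < h\<close> by (simp add: v_def)
  have contv: "continuous_on UNIV v"
    unfolding v_def by (intro continuous_intros continuous_on_compose2[OF cont]) auto
  have "((\<lambda>y. u (y + h)) \<longlongrightarrow> 1) at_top"
  proof (rule filterlim_compose[OF lim(2)])
    show "filterlim (\<lambda>y. y + h) at_top at_top"
      unfolding filterlim_at_top eventually_at_top_linorder
      by (metis diff_le_eq)
  qed
  from tendsto_diff[OF this lim(2)] have top: "(v \<longlongrightarrow> 0) at_top" by (simp add: v_def[abs_def])
  have "((\<lambda>y. u (y + h)) \<longlongrightarrow> 0) at_bot"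
  proof (rule filterlim_compose[OF lim(1)])
    show "filterlim (\<lambda>y. y + h) at_bot at_bot"
      unfolding filterlim_at_bot eventually_at_bot_linorder
      by (metis le_diff_eq)
  qed
  from tendsto_diff[OF this lim(1)] have bot: "(v \<longlongrightarrow> 0) at_bot" by (simp add: v_def[abs_def])
  obtain z where z: "\<And>y. v y \<le> v z"
    using attains_max_of_vanishing[OF contv v_pos top bot] by blast
  define r where "r = v z / (4 * h)"
  have "r > 0" using v_pos[of z] \<open>0 < h\<close> by (simp add: r_def)
  have vz: "v z = 4 * h * r" using \<open>0 < h\<close> by (simp add: r_def)
  have Iv: "has_I s v z (g (u (z + h)) - g (u z))"
    unfolding v_def
    by (rule has_I_shift_diff[OF \<open>0 < s\<close> cont _ I I, where B = 1]) (use u01 in \<open>auto simp: abs_of_nonneg\<close>)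
  have "g (u (z + h)) - g (u z) \<le> - h * (v z / (4 * h)) powr (1 + 2 * s)"
  proof (rule has_I_le_at_max[OF \<open>0 < s\<close> contv _ z Iv, where B = 1])
    show "\<bar>v y\<bar> \<le> 1" for y
      using v_pos[of y] u01(1)[of y] u01(2)[of "y + h"] by (simp add: v_def)
    show "(LINT y|lborel. v y * indicator {a..b} y) \<le> h" if "a \<le> b" for a b
      unfolding v_def by (rule integral_increment_le[OF cont u01]) (use that \<open>0 < h\<close> in auto)
  qed (use \<open>0 < h\<close> v_pos in auto)
  moreover have "- (C * v z) \<le> g (u (z + h)) - g (u z)"
    using lip[of "u (z + h)" "u z"] v_pos[of z] by (simp add: v_def)
  ultimately have "h * r powr (1 + 2 * s) \<le> C * v z" by (simp add: r_def)
  then have "(h * r) * r powr (2 * s) \<le> (h * r) * (4 * C)"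
    using \<open>r > 0\<close> by (simp add: powr_add vz mult_ac)
  then have "r powr (2 * s) \<le> 4 * C"
    using \<open>r > 0\<close> \<open>0 < h\<close> by simp
  then have "(r powr (2 * s)) powr (1 / (2 * s)) \<le> (4 * C) powr (1 / (2 * s))"
    using \<open>0 < s\<close> by (intro powr_mono2) auto
  then have "r \<le> (4 * C) powr (1 / (2 * s))"
    using \<open>0 < s\<close> \<open>r > 0\<close> by (simp add: powr_powr)
  then have "v z \<le> 4 * h * (4 * C) powr (1 / (2 * s))"
    unfolding vz using \<open>0 < h\<close> by (intro mult_left_mono) auto
  with z[of x] show ?thesis unfolding v_def by linarith
qed

section \<open>Square integrability of u' and positivity of \<gamma>\<close>

lemma potential_deriv_Lipschitz:
  assumes "multiwell_potential \<alpha> W"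
  obtains C where "\<And>a b. \<bar>deriv W a - deriv W b\<bar> \<le> C * \<bar>a - b\<bar>"
proof -
  have H: "Hoelder_class 3 \<alpha> W" using assms by (simp add: multiwell_potential_def)
  then have "(deriv ^^ 1) W differentiable (at x)" for x
    unfolding Hoelder_class_def by (metis one_less_numeral_iff semiring_norm(77))
  then have D: "(deriv W has_field_derivative deriv (deriv W) x) (at x within UNIV)" for x
    using DERIV_deriv_iff_real_differentiable by auto
  have "bounded (range ((deriv ^^ 2) W))"
    using H unfolding Hoelder_class_def by auto
  then obtain C where C: "\<And>x. norm (deriv (deriv W) x) \<le> C"
    by (auto simp: bounded_iff numeral_2_eq_2)
  have "\<bar>deriv W a - deriv W b\<bar> \<le> C * \<bar>a - b\<bar>" for a b
    using field_differentiable_bound[OF convex_UNIV D C] by auto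
  then show thesis by (rule that)
qed

lemma layer_gamma_pos:
  assumes "0 < s" "multiwell_potential \<alpha> W" "layer_solution s W u"
  shows "layer_gamma u > 0"
proof -
  have C2: "C2 u" and I: "\<And>x. has_I s u x (deriv W (u x))" and pos: "\<And>x. deriv u x > 0"
    and lim: "(u \<longlongrightarrow> 0) at_bot" "(u \<longlongrightarrow> 1) at_top"
    using assms(3) by (auto simp: layer_solution_def)
  have D: "(u has_real_derivative deriv u x) (at x)" for x
    using C2 by (simp add: C2_def DERIV_deriv_iff_real_differentiable)
  have cont': "isCont (deriv u) x" for x
    using C2 by (simp add: C2_def differentiable_imp_continuous_within)
  have cont: "continuous_on UNIV u"
    using D DERIV_isCont by (blast intro: continuous_at_imp_continuous_on)
  have mono: "u x < u y" if "x < y" for x y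
    using that D pos by (meson DERIV_pos_imp_increasing)
  have u01: "0 \<le> u x" "u x \<le> 1" for x
  proof -
    have le: "u y \<le> u z" if "y \<le> z" for y z
      using mono[of y z] that by (cases "y = z") auto
    show "0 \<le> u x"
      by (rule tendsto_upperbound[OF lim(1) eventually_mono[OF eventually_le_at_bot[of x]]])
        (auto intro: le)
    show "u x \<le> 1"
      by (rule tendsto_lowerbound[OF lim(2) eventually_mono[OF eventually_ge_at_top[of x]]])
        (auto intro: le)
  qed
  obtain C where C: "\<And>a b. \<bar>deriv W a - deriv W b\<bar> \<le> C * \<bar>a - b\<bar>"
    using potential_deriv_Lipschitz[OF assms(2)] by blast
  define K where "K = 4 * (4 * C) powr (1 / (2 * s))"
  have inc: "u (x + h) - u x \<le> h * K" if "h > 0" for x h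
    using increment_le_of_has_I[OF assms(1) cont mono lim u01 I C that, of x] by (simp add: K_def)
  have bd: "deriv u x \<le> K" for x
  proof (rule tendsto_upperbound)
    show "((\<lambda>h. (u (x + h) - u x) / h) \<longlongrightarrow> deriv u x) (at_right 0)"
      using D[of x] unfolding DERIV_def by (rule filterlim_mono) (auto simp: at_le)
    show "eventually (\<lambda>h. (u (x + h) - u x) / h \<le> K) (at_right 0)"
      using inc by (auto simp: divide_le_eq mult.commute intro!: eventually_mono[OF eventually_at_right_less[of 0]])
  qed auto
  \<comment> \<open>A nonnegative derivative of a function running from 0 to 1 is integrable over
    the line.\<close>
  have "set_integrable lborel (einterval (-\<infinity>) \<infinity>) (deriv u)"
    by (rule interval_integral_FTC_nonneg[where F = u and A = 0 and B = 1])
      (use D cont' pos lim in \<open>auto simp: ereal_tendsto_simps less_imp_le\<close>)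
  then have int: "integrable lborel (deriv u)"
    by (simp add: set_integrable_def einterval_def)
  have meas: "deriv u \<in> borel_measurable borel"
    using cont' by (intro borel_measurable_continuous_onI) (simp add: continuous_at_imp_continuous_on)
  have int2: "integrable lborel (\<lambda>x. (deriv u x)\<^sup>2)"
  proof (rule Bochner_Integration.integrable_bound[OF integrable_mult_right[OF int, of K]])
    show "AE x in lborel. norm ((deriv u x)\<^sup>2) \<le> norm (K * deriv u x)"
    proof (rule AE_I2)
      fix x
      have "deriv u x * deriv u x \<le> K * deriv u x"
        using bd[of x] pos[of x] by (intro mult_right_mono) auto
      then show "norm ((deriv u x)\<^sup>2) \<le> norm (K * deriv u x)"
        using pos[of x] by (simp add: power2_eq_square)
    qed
  qed (use meas in measurable)
  have "(LINT x|lborel. (deriv u x)\<^sup>2) \<noteq> 0"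
  proof
    assume "(LINT x|lborel. (deriv u x)\<^sup>2) = 0"
    then have "AE x in lborel. (deriv u x)\<^sup>2 = 0"
      using integral_nonneg_eq_0_iff_AE[OF int2] by simp
    then have "AE x::real in lborel. False"
      by (rule eventually_mono) (use pos in \<open>metis zero_eq_power2 less_irrefl\<close>)
    then show False by (simp add: eventually_False ae_filter_eq_bot_iff)
  qed
  then show ?thesis
    by (simp add: layer_gamma_def less_le)
qed

section \<open>Local existence for finite Lipschitz systems\<close>

text \<open>The Lipschitz condition uses a common bound \<open>B\<close> on the coordinates in
  \<open>I\<close>, so (with B = 0) \<open>f\<close> depends on these coordinates only. The sum of
  all coordinate differences serves as such a bound and tends to 0.\<close>

lemma continuous_on_sup_Lipschitz:
  fixes f :: "('a \<Rightarrow> real) \<Rightarrow> real" and w :: "'a \<Rightarrow> real \<Rightarrow> real"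
  assumes "finite I"
    and lip: "\<And>p q B. (\<And>j. j \<in> I \<Longrightarrow> \<bar>p j - q j\<bar> \<le> B) \<Longrightarrow> \<bar>f p - f q\<bar> \<le> L * B"
    and cont: "\<And>j. j \<in> I \<Longrightarrow> continuous_on S (w j)"
  shows "continuous_on S (\<lambda>t. f (\<lambda>j. w j t))"
  unfolding continuous_on_def
proof
  fix t assume "t \<in> S"
  have "((\<lambda>r. L * (\<Sum>j\<in>I. \<bar>w j r - w j t\<bar>)) \<longlongrightarrow> L * (\<Sum>j\<in>I. \<bar>w j t - w j t\<bar>)) (at t within S)"
    using cont \<open>t \<in> S\<close> by (intro tendsto_intros) (auto simp: continuous_on_def)
  then have lim: "((\<lambda>r. L * (\<Sum>j\<in>I. \<bar>w j r - w j t\<bar>)) \<longlongrightarrow> 0) (at t within S)"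
    by simp
  have "\<bar>f (\<lambda>j. w j r) - f (\<lambda>j. w j t)\<bar> \<le> L * (\<Sum>j\<in>I. \<bar>w j r - w j t\<bar>)" for r
    using \<open>finite I\<close> by (intro lip member_le_sum) auto
  then have "((\<lambda>r. f (\<lambda>j. w j r) - f (\<lambda>j. w j t)) \<longlongrightarrow> 0) (at t within S)"
    by (intro Lim_null_comparison[OF _ lim]) auto
  then show "((\<lambda>r. f (\<lambda>j. w j r)) \<longlongrightarrow> f (\<lambda>j. w j t)) (at t within S)"
    by (rule LIM_zero_cancel)
qed

text \<open>Banach's fixed point theorem for the integral equation. The differential equation is
  claimed only to the right of \<open>a\<close>, which is the direction of continuation; continuity
  on the whole line comes from freezing time outside [a, a + \<tau>].\<close>

lemma Picard_finite_system:
  fixes F :: "nat \<Rightarrow> (nat \<Rightarrow> real) \<Rightarrow> real" and p :: "nat \<Rightarrow> real" and a :: real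
  assumes "finite I" and "0 \<le> L"
    and lip: "\<And>i p q B. i \<in> I \<Longrightarrow> (\<And>j. j \<in> I \<Longrightarrow> \<bar>p j - q j\<bar> \<le> B) \<Longrightarrow> \<bar>F i p - F i q\<bar> \<le> L * B"
  obtains \<tau> w where "0 < \<tau>" and "\<And>i. i \<in> I \<Longrightarrow> w i a = p i"
    and "\<And>i. i \<in> I \<Longrightarrow> continuous_on UNIV (w i)"
    and "\<And>i t. i \<in> I \<Longrightarrow> a < t \<Longrightarrow> t < a + \<tau> \<Longrightarrow> (w i has_real_derivative F i (\<lambda>j. w j t)) (at t)"
proof -
  \<comment> \<open>The factor \<open>card I\<close> appears because the interpolating function is a
    sum over I whose terms each contribute L \<tau> to the contraction constant; the summand 1
    avoids a zero denominator.\<close>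
  define \<tau> where "\<tau> = 1 / (2 * (real (card I) * L + 1))"
  have "0 \<le> real (card I) * L" using \<open>0 \<le> L\<close> by simp
  then have "\<tau> > 0" and L\<tau>: "real (card I) * (L * \<tau>) \<le> 1 / 2"
    by (auto simp: \<tau>_def field_simps)
  \<comment> \<open>Clamping time to [a, a + \<tau>] lets the integral operator act on bounded
    functions of all times.\<close>
  define c where "c t = max a (min t (a + \<tau>))" for t
  have c: "a \<le> c t" "c t \<le> a + \<tau>" for t using \<open>\<tau> > 0\<close> by (auto simp: c_def)
  (* The library proves completeness of bounded continuous functions only over metric spaces, which
     nat is not: a family of functions indexed by I is stored as one function on the plane that
     interpolates the members between the lines {i} x R. *)
  define \<theta> where "\<theta> x = max 0 (1 - \<bar>x\<bar>)" for x :: real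
  have \<theta>: "0 \<le> \<theta> x" "\<theta> x \<le> 1" for x by (auto simp: \<theta>_def)
  have \<theta>_nat: "\<theta> (real i - real j) = (if i = j then 1 else 0)" for i j
    by (auto simp: \<theta>_def)
  define g where "g Y i r = F i (\<lambda>j. apply_bcontfun Y (real j, r))" for Y :: "(real \<times> real) \<Rightarrow>\<^sub>C real" and i r
  define H where "H Y i t = p i + integral {a..c t} (g Y i)" for Y i t
  define G where "G Y = (\<lambda>z. \<Sum>i\<in>I. \<theta> (fst z - real i) * H Y i (snd z))" for Y
  have contg: "continuous_on S (g Y i)" if "i \<in> I" for Y i S
    unfolding g_def
    by (rule continuous_on_sup_Lipschitz[OF \<open>finite I\<close> lip[OF that]])
      (auto intro!: continuous_on_compose2[OF continuous_on_apply_bcontfun] continuous_intros)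
  have intg: "g Y i integrable_on {a..c t}" if "i \<in> I" for Y i t
    using contg[OF that] by (rule integrable_continuous_real)
  have contH: "continuous_on UNIV (H Y i)" if "i \<in> I" for Y i
    unfolding H_def
    by (intro continuous_intros continuous_on_compose2[OF indefinite_integral_continuous_1[of "g Y i" a "a + \<tau>"]])
      (use c contg[OF that] in \<open>auto simp: c_def intro!: continuous_intros integrable_continuous_real\<close>)
  have G_bcontfun: "G Y \<in> bcontfun" for Y
  proof (rule bcontfun_normI)
    show "continuous_on UNIV (G Y)"
      unfolding G_def \<theta>_def
      by (intro continuous_intros continuous_on_compose2[OF contH]) auto
    define M where "M = (\<Sum>i\<in>I. \<bar>F i (\<lambda>_. 0)\<bar>) + L * norm Y"
    have "M \<ge> 0" unfolding M_def using \<open>0 \<le> L\<close> by (intro add_nonneg_nonneg sum_nonneg) auto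
    have H_le: "\<bar>H Y i t\<bar> \<le> \<bar>p i\<bar> + M * \<tau>" if "i \<in> I" for i t
    proof -
      have g_le: "\<bar>g Y i r\<bar> \<le> M" for r
      proof -
        have "\<bar>g Y i r - F i (\<lambda>_. 0)\<bar> \<le> L * norm Y"
          unfolding g_def using norm_bounded[of Y] by (intro lip that) auto
        moreover have "\<bar>F i (\<lambda>_. 0)\<bar> \<le> (\<Sum>i\<in>I. \<bar>F i (\<lambda>_. 0)\<bar>)"
          using \<open>finite I\<close> that by (intro member_le_sum) auto
        ultimately show ?thesis unfolding M_def by linarith
      qed
      have "norm (integral {a..c t} (g Y i)) \<le> M * (c t - a)"
        by (rule integral_bound) (use c contg[OF that] g_le in auto)
      also have "\<dots> \<le> M * \<tau>"
        using c(2)[of t] \<open>M \<ge> 0\<close> by (intro mult_left_mono) auto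
      finally have "\<bar>integral {a..c t} (g Y i)\<bar> \<le> M * \<tau>" by simp
      then show ?thesis unfolding H_def by linarith
    qed
    show "norm (G Y z) \<le> (\<Sum>i\<in>I. \<bar>p i\<bar> + M * \<tau>)" for z
      unfolding G_def
    proof (rule sum_norm_le)
      fix i assume "i \<in> I"
      have "norm (\<theta> (fst z - real i) * H Y i (snd z)) \<le> 1 * \<bar>H Y i (snd z)\<bar>"
        unfolding norm_mult using \<theta> by (intro mult_mono) auto
      then show "norm (\<theta> (fst z - real i) * H Y i (snd z)) \<le> \<bar>p i\<bar> + M * \<tau>"
        using H_le[OF \<open>i \<in> I\<close>, of "snd z"] by simp
    qed
  qed
  have app: "apply_bcontfun (Bcontfun (G Y)) = G Y" for Y
    by (rule Bcontfun_inverse[OF G_bcontfun])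
  have "\<exists>!Y. Bcontfun (G Y) = Y"
  proof (rule banach_fix_type[where c = "1 / 2"]; safe?)
    fix Y Z :: "(real \<times> real) \<Rightarrow>\<^sub>C real"
    show "dist (Bcontfun (G Y)) (Bcontfun (G Z)) \<le> 1 / 2 * dist Y Z"
    proof (rule dist_bound)
      fix z :: "real \<times> real"
      have "norm (\<Sum>i\<in>I. \<theta> (fst z - real i) * (H Y i (snd z) - H Z i (snd z))) \<le> (\<Sum>i\<in>I. L * \<tau> * dist Y Z)"
      proof (rule sum_norm_le)
        fix i assume "i \<in> I"
        have "\<bar>g Y i r - g Z i r\<bar> \<le> L * dist Y Z" for r
          unfolding g_def using dist_bounded[of Y _ Z] by (intro lip \<open>i \<in> I\<close>) (auto simp: dist_real_def)
        then have "norm (integral {a..c (snd z)} (\<lambda>r. g Y i r - g Z i r)) \<le> (L * dist Y Z) * (c (snd z) - a)"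
          by (intro integral_bound continuous_on_diff contg \<open>i \<in> I\<close> c) auto
        also have "\<dots> \<le> (L * dist Y Z) * \<tau>"
          using c(2)[of "snd z"] \<open>0 \<le> L\<close> by (intro mult_left_mono) auto
        finally have "\<bar>H Y i (snd z) - H Z i (snd z)\<bar> \<le> L * \<tau> * dist Y Z"
          by (simp add: H_def integral_diff[OF intg[OF \<open>i \<in> I\<close>] intg[OF \<open>i \<in> I\<close>]] mult_ac)
        moreover have "norm (\<theta> (fst z - real i) * (H Y i (snd z) - H Z i (snd z)))
            \<le> 1 * \<bar>H Y i (snd z) - H Z i (snd z)\<bar>"
          unfolding norm_mult using \<theta> by (intro mult_mono) auto
        ultimately show "norm (\<theta> (fst z - real i) * (H Y i (snd z) - H Z i (snd z))) \<le> L * \<tau> * dist Y Z"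
          by simp
      qed
      also have "\<dots> = real (card I) * (L * \<tau>) * dist Y Z" by simp
      also have "\<dots> \<le> 1 / 2 * dist Y Z"
        using L\<tau> by (intro mult_right_mono) auto
      finally show "dist (apply_bcontfun (Bcontfun (G Y)) z) (apply_bcontfun (Bcontfun (G Z)) z) \<le> 1 / 2 * dist Y Z"
        unfolding app by (simp add: G_def dist_real_def sum_subtractf[symmetric] right_diff_distrib)
    qed
  qed auto
  then obtain Y where Y: "Bcontfun (G Y) = Y" by blast
  define w where "w i t = apply_bcontfun Y (real i, t)" for i t
  have w: "w i t = p i + integral {a..c t} (g Y i)" if "i \<in> I" for i t
  proof -
    have "w i t = (\<Sum>j\<in>I. \<theta> (real i - real j) * H Y j t)"
      using app[of Y] unfolding Y by (simp add: w_def G_def)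
    also have "\<dots> = (\<Sum>j\<in>I. if i = j then H Y j t else 0)"
      by (rule sum.cong) (auto simp: \<theta>_nat)
    finally show ?thesis using that \<open>finite I\<close> by (simp add: H_def)
  qed
  show thesis
  proof (rule that[of \<tau> w])
    show "w i a = p i" if "i \<in> I" for i
      using w[OF that, of a] \<open>\<tau> > 0\<close> by (simp add: c_def)
    show "continuous_on UNIV (w i)" for i
      unfolding w_def by (intro continuous_on_compose2[OF continuous_on_apply_bcontfun] continuous_intros) auto
    fix i t assume "i \<in> I" and t: "a < t" "t < a + \<tau>"
    have "((\<lambda>t. integral {a..t} (g Y i)) has_real_derivative g Y i t) (at t within {a..a + \<tau>})"
      by (rule integral_has_real_derivative) (use contg[OF \<open>i \<in> I\<close>] t in auto)
    from DERIV_add[OF DERIV_const[of "p i"] this]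
    have "((\<lambda>t. p i + integral {a..t} (g Y i)) has_real_derivative g Y i t) (at t)"
      using t by (simp add: at_within_Icc_at)
    then have "(w i has_real_derivative g Y i t) (at t)"
      by (rule has_field_derivative_transform_within_open[of _ _ _ "{a<..<a + \<tau>}"])
        (use t in \<open>auto simp: w[OF \<open>i \<in> I\<close>] c_def\<close>)
    then show "(w i has_real_derivative F i (\<lambda>j. w j t)) (at t)"
      by (simp add: g_def w_def)
  qed (rule \<open>\<tau> > 0\<close>)
qed

text \<open>The fundamental theorem of calculus tolerates one exceptional point, so f is a constant
  plus the integral of the continuous g, and this is differentiable at c too. It serves the instant
  at which two solutions are glued.\<close>

lemma has_real_derivative_remove_singularity:
  fixes f g :: "real \<Rightarrow> real"
  assumes "c \<in> {a<..<b}" "continuous_on {a..b} f" "continuous_on {a..b} g"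
    and D: "\<And>t. t \<in> {a<..<b} - {c} \<Longrightarrow> (f has_real_derivative g t) (at t)"
  shows "(f has_real_derivative g c) (at c)"
proof -
  have I: "(g has_integral f t - f a) {a..t}" if "t \<in> {a..b}" for t
    by (rule fundamental_theorem_of_calculus_interior_strong[of "{c}"])
      (use assms that in \<open>auto simp: has_real_derivative_iff_has_vector_derivative[symmetric]
        intro: continuous_on_subset\<close>)
  have "((\<lambda>t. integral {a..t} g) has_real_derivative g c) (at c within {a..b})"
    using integral_has_real_derivative[OF assms(3), of c] assms(1) by simp
  from DERIV_add[OF DERIV_const[of "f a"] this] have "((\<lambda>t. f a + integral {a..t} g) has_real_derivative g c) (at c)"
    using assms(1) by (simp add: at_within_Icc_at)
  then show ?thesis
    by (rule has_field_derivative_transform_within_open[of _ _ _ "{a<..<b}"])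
      (use assms(1) integral_unique[OF I] in auto)
qed

section \<open>Alternating sums of repulsive forces\<close>

definition repulsion :: "real \<Rightarrow> real \<Rightarrow> real" where
  "repulsion s r = r powr (- (2 * s)) / (2 * s)"

lemma repulsion_nonneg: "0 < s \<Longrightarrow> 0 \<le> repulsion s r"
  by (simp add: repulsion_def)

lemma has_real_derivative_repulsion:
  assumes "0 < s" "0 < r"
  shows "(repulsion s has_real_derivative - (r powr - (2 * s + 1))) (at r)"
  unfolding repulsion_def[abs_def]
  using assms by (auto intro!: derivative_eq_intros simp: powr_diff powr_minus field_simps)

lemma repulsion_antimono: "0 < s \<Longrightarrow> 0 < a \<Longrightarrow> a \<le> b \<Longrightarrow> repulsion s b \<le> repulsion s a"
  unfolding repulsion_def by (intro divide_right_mono powr_mono2') auto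

text \<open>Convexity in increment form: the derivative of the drop is a difference of two slopes.
  This shape makes differences of repulsions, seen from two neighbouring particles, again a monotone
  sequence.\<close>

lemma repulsion_drop_antimono:
  assumes "0 < s" "0 < a" "a \<le> b" "0 \<le> h"
  shows "repulsion s b - repulsion s (b + h) \<le> repulsion s a - repulsion s (a + h)"
proof (rule DERIV_nonpos_imp_nonincreasing[where f = "\<lambda>r. repulsion s r - repulsion s (r + h)"])
  fix r assume r: "a \<le> r" "r \<le> b"
  have "((\<lambda>r. repulsion s r - repulsion s (r + h)) has_real_derivative
      - (r powr - (2 * s + 1)) - - ((r + h) powr - (2 * s + 1))) (at r)"
    using assms r by (intro DERIV_diff has_real_derivative_repulsion DERIV_shift[THEN iffD1]) auto
  moreover have "(r + h) powr - (2 * s + 1) \<le> r powr - (2 * s + 1)"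
    using assms r by (intro powr_mono2') auto
  ultimately show "\<exists>y. ((\<lambda>r. repulsion s r - repulsion s (r + h)) has_real_derivative y) (at r) \<and> y \<le> 0"
    by (intro exI conjI) auto
qed (use assms in auto)

text \<open>A convex decreasing function is flattest at the right end, so up to D the repulsion
  falls at least at the rate D^-(2s+1).\<close>

lemma repulsion_slope_ge:
  assumes "0 < s" "0 < a" "a \<le> b" "b \<le> D"
  shows "repulsion s b + D powr - (2 * s + 1) * b \<le> repulsion s a + D powr - (2 * s + 1) * a"
proof (rule DERIV_nonpos_imp_nonincreasing[where f = "\<lambda>r. repulsion s r + D powr - (2 * s + 1) * r"])
  fix r assume r: "a \<le> r" "r \<le> b"
  have "((\<lambda>r. repulsion s r + D powr - (2 * s + 1) * r) has_real_derivative
      - (r powr - (2 * s + 1)) + D powr - (2 * s + 1)) (at r)"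
    using assms r by (intro DERIV_add has_real_derivative_repulsion DERIV_cmult_Id) auto
  moreover have "D powr - (2 * s + 1) \<le> r powr - (2 * s + 1)"
    using assms r by (intro powr_mono2') auto
  ultimately show "\<exists>y. ((\<lambda>r. repulsion s r + D powr - (2 * s + 1) * r) has_real_derivative y) (at r) \<and> y \<le> 0"
    by (intro exI conjI) auto
qed (use assms in auto)

text \<open>The opposite end of convexity: from \<delta> on the repulsion falls at most at the rate
  \<delta>^-(2s+1), which becomes the Lipschitz constant after truncation at \<delta>.\<close>

lemma repulsion_slope_le:
  assumes "0 < s" "0 < \<delta>" "\<delta> \<le> a" "a \<le> b"
  shows "repulsion s a + \<delta> powr - (2 * s + 1) * a \<le> repulsion s b + \<delta> powr - (2 * s + 1) * b"
proof (rule DERIV_nonneg_imp_nondecreasing[where f = "\<lambda>r. repulsion s r + \<delta> powr - (2 * s + 1) * r"])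
  fix r assume r: "a \<le> r" "r \<le> b"
  have "((\<lambda>r. repulsion s r + \<delta> powr - (2 * s + 1) * r) has_real_derivative
      - (r powr - (2 * s + 1)) + \<delta> powr - (2 * s + 1)) (at r)"
    using assms r by (intro DERIV_add has_real_derivative_repulsion DERIV_cmult_Id) auto
  moreover have "r powr - (2 * s + 1) \<le> \<delta> powr - (2 * s + 1)"
    using assms r by (intro powr_mono2') auto
  ultimately show "\<exists>y. ((\<lambda>r. repulsion s r + \<delta> powr - (2 * s + 1) * r) has_real_derivative y) (at r) \<and> 0 \<le> y"
    by (intro exI conjI) auto
qed (use assms in auto)

lemma repulsion_truncated_Lipschitz:
  assumes "0 < s" "0 < \<delta>"
  shows "\<bar>repulsion s (max a \<delta>) - repulsion s (max b \<delta>)\<bar> \<le> \<delta> powr - (2 * s + 1) * \<bar>a - b\<bar>"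
proof (induction a b rule: linorder_wlog)
  case (le a b)
  define c where "c = \<delta> powr - (2 * s + 1)"
  have "repulsion s (max b \<delta>) \<le> repulsion s (max a \<delta>)"
    using assms le by (intro repulsion_antimono) auto
  moreover have "repulsion s (max a \<delta>) + c * max a \<delta> \<le> repulsion s (max b \<delta>) + c * max b \<delta>"
    unfolding c_def using assms le by (intro repulsion_slope_le) auto
  moreover have "c * (max b \<delta> - max a \<delta>) \<le> c * (b - a)"
    using le by (intro mult_left_mono) (auto simp: c_def)
  ultimately show ?case using le unfolding c_def[symmetric] by (simp add: right_diff_distrib)
next
  case (sym a b)
  then show ?case by (simp add: abs_minus_commute)
qed

lemma interaction_pos: "0 < r \<Longrightarrow> r / (2 * s * \<bar>r\<bar> powr (1 + 2 * s)) = repulsion s r"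
  by (simp add: repulsion_def powr_add powr_minus field_simps)

lemma interaction_neg: "r < 0 \<Longrightarrow> r / (2 * s * \<bar>r\<bar> powr (1 + 2 * s)) = - repulsion s (- r)"
  using interaction_pos[of "- r" s] by simp

section \<open>Alternating sums of monotone sequences\<close>

text \<open>The Leibniz estimate: splitting off the first term gives S_m = a_m - S_(m+1), and
  S_(m+1) lies in [0, a_(m+1)] by induction. The factor \<open>\<zeta> m\<close> gives the leading
  term a positive sign.\<close>

lemma alternating_sum_antimono:
  fixes \<zeta> a :: "nat \<Rightarrow> real"
  assumes "m \<le> n" and "\<And>i. m \<le> i \<Longrightarrow> i \<le> n \<Longrightarrow> \<zeta> i * \<zeta> i = 1"
    and "\<And>i. m \<le> i \<Longrightarrow> i < n \<Longrightarrow> \<zeta> i = - \<zeta> (Suc i)"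
    and "\<And>i. m \<le> i \<Longrightarrow> i \<le> n \<Longrightarrow> 0 \<le> a i" and "\<And>i. m \<le> i \<Longrightarrow> i < n \<Longrightarrow> a (Suc i) \<le> a i"
  shows "(\<Sum>j=m..n. \<zeta> m * \<zeta> j * a j) \<in> {0..a m}"
  using assms
proof (induction rule: inc_induct)
  case base
  then show ?case by simp
next
  case (step m)
  have "(\<Sum>j=Suc m..n. \<zeta> (Suc m) * \<zeta> j * a j) \<in> {0..a (Suc m)}"
    using step by simp
  moreover have "(\<Sum>j=m..n. \<zeta> m * \<zeta> j * a j) = a m - (\<Sum>j=Suc m..n. \<zeta> (Suc m) * \<zeta> j * a j)"
    using step by (simp add: sum.atLeast_Suc_atMost[of m n] sum_negf)
  moreover have "a (Suc m) \<le> a m"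
    using step by simp
  ultimately show ?case by auto
qed

text \<open>The mirror image, with the dominant term at the end; it applies when the terms come from
  particles to the left, whose repulsion grows with the index.\<close>

lemma alternating_sum_mono:
  fixes \<zeta> a :: "nat \<Rightarrow> real"
  assumes "m \<le> n" and "\<And>i. m \<le> i \<Longrightarrow> i \<le> n \<Longrightarrow> \<zeta> i * \<zeta> i = 1"
    and "\<And>i. m \<le> i \<Longrightarrow> i < n \<Longrightarrow> \<zeta> (Suc i) = - \<zeta> i"
    and "\<And>i. m \<le> i \<Longrightarrow> i \<le> n \<Longrightarrow> 0 \<le> a i" and "\<And>i. m \<le> i \<Longrightarrow> i < n \<Longrightarrow> a i \<le> a (Suc i)"
  shows "(\<Sum>j=m..n. \<zeta> n * \<zeta> j * a j) \<in> {0..a n}"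
  using assms
proof (induction rule: dec_induct)
  case base
  then show ?case by simp
next
  case (step n)
  have "(\<Sum>j=m..n. \<zeta> n * \<zeta> j * a j) \<in> {0..a n}"
    using step by simp
  moreover have "\<zeta> (Suc n) * \<zeta> (Suc n) = 1" "\<zeta> (Suc n) = - \<zeta> n"
    using step by simp_all
  then have "(\<Sum>j=m..Suc n. \<zeta> (Suc n) * \<zeta> j * a j) = a (Suc n) - (\<Sum>j=m..n. \<zeta> n * \<zeta> j * a j)"
    using step by (simp add: sum_negf)
  moreover have "a n \<le> a (Suc n)"
    using step by simp
  ultimately show ?case by auto
qed

text \<open>Neighbouring charges cancel in pairs. This is where the parity of N enters: subtracting
  a constant R from each of the N - 1 repulsions acting on an outer particle costs R for even N and
  nothing for odd N.\<close>

lemma alternating_sum_const: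
  fixes \<zeta> :: "nat \<Rightarrow> real"
  assumes "m \<le> n" and "\<And>i. m \<le> i \<Longrightarrow> i \<le> n \<Longrightarrow> \<zeta> i * \<zeta> i = 1"
    and "\<And>i. m \<le> i \<Longrightarrow> i < n \<Longrightarrow> \<zeta> (Suc i) = - \<zeta> i"
  shows "(\<Sum>j=m..n. \<zeta> j) = (if even (n - m) then \<zeta> m else 0) \<and> \<zeta> n = (if even (n - m) then \<zeta> m else - \<zeta> m)"
  using assms
proof (induction rule: dec_induct)
  case base
  then show ?case by simp
next
  case (step n)
  then show ?case by (auto simp: Suc_diff_le)
qed

section \<open>Forces on ordered particles with alternating charges\<close>

locale alternating_charges =
  fixes s \<gamma> :: real and N :: nat and \<zeta> :: "nat \<Rightarrow> real"
  assumes s_pos: "0 < s" and \<gamma>_pos: "0 < \<gamma>" and N_ge_2: "2 \<le> N"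
    and charge: "\<And>i. 1 \<le> i \<Longrightarrow> i \<le> N \<Longrightarrow> \<zeta> i * \<zeta> i = 1"
    and alternating: "\<And>i. 1 \<le> i \<Longrightarrow> i < N \<Longrightarrow> \<zeta> (Suc i) = - \<zeta> i"
begin

abbreviation velocity :: "(nat \<Rightarrow> real) \<Rightarrow> nat \<Rightarrow> real" where
  "velocity \<equiv> particle_velocity s \<gamma> N \<zeta>"

definition ordered :: "(nat \<Rightarrow> real) \<Rightarrow> bool" where
  "ordered p \<longleftrightarrow> (\<forall>i\<in>{1..N}. \<forall>j\<in>{1..N}. i < j \<longrightarrow> p i < p j)"

lemma orderedD: "ordered p \<Longrightarrow> i < j \<Longrightarrow> 1 \<le> i \<Longrightarrow> j \<le> N \<Longrightarrow> p i < p j"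
  by (auto simp: ordered_def)

text \<open>The numerator vanishes for j = i, so this term is 0 and sums may run over whole
  intervals of indices.\<close>

definition interaction :: "(nat \<Rightarrow> real) \<Rightarrow> nat \<Rightarrow> nat \<Rightarrow> real" where
  "interaction p i j = \<zeta> i * \<zeta> j * ((p i - p j) / (2 * s * \<bar>p i - p j\<bar> powr (1 + 2 * s)))"

lemma velocity_eq: "velocity p i = \<gamma> * (\<Sum>j\<in>{1..N}. interaction p i j)"
proof -
  have "(\<Sum>j\<in>{1..N} - {i}. interaction p i j) = (\<Sum>j\<in>{1..N}. interaction p i j)"
    by (rule sum.mono_neutral_left) (auto simp: interaction_def)
  then show ?thesis by (simp add: particle_velocity_def interaction_def)
qed

lemma interaction_skew: "interaction p j i = - interaction p i j"
proof -
  have "(p j - p i) / (2 * s * \<bar>p j - p i\<bar> powr (1 + 2 * s)) = - ((p i - p j) / (2 * s * \<bar>p i - p j\<bar> powr (1 + 2 * s)))"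
    by (metis abs_minus_commute minus_diff_eq minus_divide_left)
  then show ?thesis by (simp add: interaction_def)
qed

lemma interaction_greater: "p i < p j \<Longrightarrow> interaction p i j = - (\<zeta> i * \<zeta> j * repulsion s (p j - p i))"
  unfolding interaction_def by (subst interaction_neg) auto

lemma interaction_less: "p j < p i \<Longrightarrow> interaction p i j = \<zeta> i * \<zeta> j * repulsion s (p i - p j)"
  unfolding interaction_def by (subst interaction_pos) auto

text \<open>Interactions inside the block {1..k} cancel by skew symmetry, which leaves the forces
  across the cut after k. For k = N nothing is left: the centre of mass is at rest.\<close>

lemma sum_velocity:
  assumes "k \<le> N"
  shows "(\<Sum>i=1..k. velocity p i) = \<gamma> * (\<Sum>i=1..k. \<Sum>j=Suc k..N. interaction p i j)"
proof -
  have "(\<Sum>i=1..k. \<Sum>j=1..k. interaction p i j) = (\<Sum>i=1..k. \<Sum>j=1..k. - interaction p i j)"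
    by (subst sum.swap) (simp add: interaction_skew[symmetric])
  then have inner: "(\<Sum>i=1..k. \<Sum>j=1..k. interaction p i j) = 0"
    by (simp add: sum_negf)
  have "{1..N} = {1..k} \<union> {Suc k..N}" using assms by auto
  then have "(\<Sum>j\<in>{1..N}. interaction p i j) = (\<Sum>j=1..k. interaction p i j) + (\<Sum>j=Suc k..N. interaction p i j)" for i
    by (simp add: sum.union_disjoint)
  then show ?thesis
    using inner by (simp add: velocity_eq sum_distrib_left[symmetric] sum.distrib)
qed

(* The interaction between the first k particles and the others is an iterated alternating sum.
   Convexity of repulsion makes the inner sum monotone in the position of the outer particle. *)
lemma sum_velocity_nonneg:
  assumes "ordered p" "k \<le> N"
  shows "0 \<le> (\<Sum>i=1..k. velocity p i)"
proof (cases "k = 0 \<or> k = N")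
  case True
  then show ?thesis
  proof
    assume "k = N"
    then show ?thesis using sum_velocity[of N p] by simp
  qed simp
next
  case False
  then have k: "1 \<le> k" "k < N" using assms by auto
  define A where "A i = (\<Sum>j=Suc k..N. \<zeta> (Suc k) * \<zeta> j * repulsion s (p j - p i))" for i
  have less: "p i < p j" if "1 \<le> i" "i < j" "j \<le> N" for i j
    using assms(1) that orderedD by blast
  have A_nonneg: "0 \<le> A i" if "1 \<le> i" "i \<le> k" for i
  proof -
    have "A i \<in> {0..repulsion s (p (Suc k) - p i)}"
      unfolding A_def
      by (rule alternating_sum_antimono)
        (use k that less s_pos in \<open>auto simp: charge alternating less_imp_le intro!: repulsion_nonneg repulsion_antimono\<close>)
    then show ?thesis by simp
  qed
  have A_mono: "A i \<le> A (Suc i)" if "1 \<le> i" "i < k" for i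
  proof -
    have "A (Suc i) - A i = (\<Sum>j=Suc k..N. \<zeta> (Suc k) * \<zeta> j * (repulsion s (p j - p (Suc i)) - repulsion s (p j - p i)))"
      by (simp add: A_def sum_subtractf[symmetric] right_diff_distrib)
    also have "\<dots> \<in> {0..repulsion s (p (Suc k) - p (Suc i)) - repulsion s (p (Suc k) - p i)}"
    proof (rule alternating_sum_antimono)
      fix j :: nat assume j: "Suc k \<le> j"
      show "0 \<le> repulsion s (p j - p (Suc i)) - repulsion s (p j - p i)" if "j \<le> N"
        using repulsion_antimono[OF s_pos, of "p j - p (Suc i)" "p j - p i"]
          less[of i "Suc i"] less[of "Suc i" j] j that \<open>1 \<le> i\<close> \<open>i < k\<close> by simp
      show "repulsion s (p (Suc j) - p (Suc i)) - repulsion s (p (Suc j) - p i)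
          \<le> repulsion s (p j - p (Suc i)) - repulsion s (p j - p i)" if "j < N"
        using repulsion_drop_antimono[OF s_pos, of "p j - p (Suc i)" "p (Suc j) - p (Suc i)" "p (Suc i) - p i"]
          less[of i "Suc i"] less[of "Suc i" j] less[of j "Suc j"] j that \<open>1 \<le> i\<close> \<open>i < k\<close> by simp
    qed (use k in \<open>auto simp: charge alternating\<close>)
    finally show ?thesis by simp
  qed
  \<comment> \<open>The charges next to the cut satisfy \<zeta>_k \<zeta>_(k+1) = -1. This absorbs
    the minus sign of the interaction, so the double sum alternates in both indices with positive
    leading term.\<close>
  have "(\<Sum>j=Suc k..N. interaction p i j) = \<zeta> k * \<zeta> i * A i" if "1 \<le> i" "i \<le> k" for i
  proof -
    have "interaction p i j = \<zeta> k * \<zeta> i * (\<zeta> (Suc k) * \<zeta> j * repulsion s (p j - p i))" if "j \<in> {Suc k..N}" for j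
    proof -
      have "\<zeta> k * \<zeta> i * (\<zeta> (Suc k) * \<zeta> j * repulsion s (p j - p i)) = - ((\<zeta> k * \<zeta> k) * (\<zeta> i * \<zeta> j * repulsion s (p j - p i)))"
        using k by (simp add: alternating)
      then show ?thesis
        using interaction_greater[OF less[of i j]] that k \<open>1 \<le> i\<close> \<open>i \<le> k\<close> by (simp add: charge)
    qed
    then show ?thesis by (simp add: A_def sum_distrib_left)
  qed
  then have "(\<Sum>i=1..k. \<Sum>j=Suc k..N. interaction p i j) = (\<Sum>i=1..k. \<zeta> k * \<zeta> i * A i)"
    by simp
  also have "\<dots> \<in> {0..A k}"
    by (rule alternating_sum_mono) (use k A_nonneg A_mono in \<open>auto simp: charge alternating\<close>)
  finally show ?thesis
    unfolding sum_velocity[OF assms(2)] using \<gamma>_pos by simp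
qed

text \<open>This is the cut after the first particle. Since \<zeta>_2 = -\<zeta>_1, the attraction
  by the nearest neighbour becomes the positive leading term.\<close>

lemma velocity_first:
  assumes "ordered p"
  shows "velocity p 1 = \<gamma> * (\<Sum>j=2..N. \<zeta> 2 * \<zeta> j * repulsion s (p j - p 1))"
proof -
  have "velocity p 1 = (\<Sum>i=1..1. velocity p i)" by simp
  also have "\<dots> = \<gamma> * (\<Sum>j=2..N. interaction p 1 j)"
    using N_ge_2 by (subst sum_velocity) (auto simp: numeral_2_eq_2)
  also have "(\<Sum>j=2..N. interaction p 1 j) = (\<Sum>j=2..N. \<zeta> 2 * \<zeta> j * repulsion s (p j - p 1))"
    using alternating[of 1] N_ge_2 orderedD[OF assms, of 1]
    by (intro sum.cong refl, subst interaction_greater) (auto simp: numeral_2_eq_2)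
  finally show ?thesis .
qed

text \<open>All velocities add up to 0, so the last one is minus the partial sum at the cut after N
  - 1.\<close>

lemma velocity_last:
  assumes "ordered p"
  shows "velocity p N = - (\<gamma> * (\<Sum>i=1..N-1. \<zeta> (N-1) * \<zeta> i * repulsion s (p N - p i)))"
proof -
  obtain M where M: "N = Suc M" "1 \<le> M" using N_ge_2 by (cases N) auto
  have "(\<Sum>i=1..N. velocity p i) = 0" using sum_velocity[of N p] by simp
  then have "velocity p N = - (\<Sum>i=1..M. velocity p i)" by (simp add: M)
  also have "\<dots> = - (\<gamma> * (\<Sum>i=1..M. \<Sum>j=Suc M..N. interaction p i j))"
    by (subst sum_velocity) (simp_all add: M)
  also have "(\<Sum>i=1..M. \<Sum>j=Suc M..N. interaction p i j) = (\<Sum>i=1..M. \<zeta> M * \<zeta> i * repulsion s (p N - p i))"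
    using alternating[of M] M orderedD[OF assms, of _ N]
    by (intro sum.cong refl) (simp add: interaction_greater)
  finally show ?thesis by (simp add: M)
qed

text \<open>R is the smallest repulsion on the configuration. Subtracting it keeps the terms
  nonnegative and monotone, and an odd number of charges makes the sum drop by exactly R. Each outer
  particle thus moves inward with speed at least \<gamma> R, and 2 R = W^(-2s) / s for the width
  W.\<close>

lemma velocity_gap_even:
  assumes "ordered p" "even N"
  shows "velocity p N - velocity p 1 \<le> - (\<gamma> / s) * (p N - p 1) powr - (2 * s)"
proof -
  define R where "R = repulsion s (p N - p 1)"
  have less: "p i < p j" if "1 \<le> i" "i < j" "j \<le> N" for i j
    using assms(1) that orderedD by blast
  obtain M where M: "N = Suc M" "1 \<le> M" using N_ge_2 by (cases N) auto
  have "0 \<le> (\<Sum>j=2..N. \<zeta> 2 * \<zeta> j * (repulsion s (p j - p 1) - R))"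
  proof -
    have "(\<Sum>j=2..N. \<zeta> 2 * \<zeta> j * (repulsion s (p j - p 1) - R)) \<in> {0..repulsion s (p 2 - p 1) - R}"
    proof (rule alternating_sum_antimono)
      fix j :: nat assume j: "2 \<le> j"
      show "0 \<le> repulsion s (p j - p 1) - R" if "j \<le> N"
        unfolding R_def using repulsion_antimono[OF s_pos, of "p j - p 1" "p N - p 1"] less[of 1 j] less[of j N] j that
        by (cases "j = N") auto
      show "repulsion s (p (Suc j) - p 1) - R \<le> repulsion s (p j - p 1) - R" if "j < N"
        using repulsion_antimono[OF s_pos, of "p j - p 1" "p (Suc j) - p 1"] less[of 1 j] less[of j "Suc j"] j that by simp
    qed (use N_ge_2 in \<open>auto simp: charge alternating\<close>)
    then show ?thesis by simp
  qed
  moreover have "(\<Sum>j=2..N. \<zeta> j) = \<zeta> 2"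
    using alternating_sum_const[of 2 N \<zeta>] N_ge_2 assms(2) by (auto simp: charge alternating)
  then have "(\<Sum>j=2..N. \<zeta> 2 * \<zeta> j * R) = R"
    using N_ge_2 by (simp add: sum_distrib_right[symmetric] sum_distrib_left[symmetric] charge)
  ultimately have "R \<le> (\<Sum>j=2..N. \<zeta> 2 * \<zeta> j * repulsion s (p j - p 1))"
    by (simp add: right_diff_distrib sum_subtractf)
  then have first: "\<gamma> * R \<le> velocity p 1"
    unfolding velocity_first[OF assms(1)] using \<gamma>_pos by (intro mult_left_mono) auto
  have "0 \<le> (\<Sum>i=1..M. \<zeta> M * \<zeta> i * (repulsion s (p N - p i) - R))"
  proof -
    have "(\<Sum>i=1..M. \<zeta> M * \<zeta> i * (repulsion s (p N - p i) - R)) \<in> {0..repulsion s (p N - p M) - R}"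
    proof (rule alternating_sum_mono)
      fix j :: nat assume j: "1 \<le> j"
      show "0 \<le> repulsion s (p N - p j) - R" if "j \<le> M"
        unfolding R_def using repulsion_antimono[OF s_pos, of "p N - p j" "p N - p 1"] less[of 1 j] less[of j N] j that M
        by (cases "j = 1") auto
      show "repulsion s (p N - p j) - R \<le> repulsion s (p N - p (Suc j)) - R" if "j < M"
        using repulsion_antimono[OF s_pos, of "p N - p (Suc j)" "p N - p j"] less[of "Suc j" N] less[of j "Suc j"] j that M by simp
    qed (use M in \<open>auto simp: charge alternating\<close>)
    then show ?thesis by simp
  qed
  moreover have "(\<Sum>i=1..M. \<zeta> i) = \<zeta> M"
    using alternating_sum_const[of 1 M \<zeta>] M assms(2) by (auto simp: charge alternating)
  then have "(\<Sum>i=1..M. \<zeta> M * \<zeta> i * R) = R"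
    using M by (simp add: sum_distrib_right[symmetric] sum_distrib_left[symmetric] charge)
  ultimately have "R \<le> (\<Sum>i=1..M. \<zeta> M * \<zeta> i * repulsion s (p N - p i))"
    by (simp add: right_diff_distrib sum_subtractf)
  then have "\<gamma> * R \<le> \<gamma> * (\<Sum>i=1..M. \<zeta> M * \<zeta> i * repulsion s (p N - p i))"
    using \<gamma>_pos by (intro mult_left_mono) auto
  with velocity_last[OF assms(1)] have "velocity p N \<le> - (\<gamma> * R)" by (simp add: M)
  with first have "velocity p N - velocity p 1 \<le> - (2 * (\<gamma> * R))" by linarith
  also have "\<dots> = - (\<gamma> / s) * (p N - p 1) powr - (2 * s)"
    using s_pos by (simp add: R_def repulsion_def field_simps)
  finally show ?thesis .
qed

(* With c the smallest slope of repulsion on the configuration, repulsion s r + c r is still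
   decreasing, so replacing repulsion by the linear function - c r lowers the alternating sums;
   the two linear sums telescope to the width. *)
lemma velocity_gap_odd:
  assumes "ordered p" "odd N"
  shows "velocity p N - velocity p 1 \<le> - \<gamma> * (p N - p 1) powr - (2 * s)"
proof -
  define W where "W = p N - p 1"
  define c where "c = W powr - (2 * s + 1)"
  \<comment> \<open>With this constant \<open>a\<close> vanishes at the full width W, hence is
    nonnegative on (0, W].\<close>
  define R where "R = repulsion s W + c * W"
  define a where "a r = repulsion s r + c * r - R" for r
  have less: "p i < p j" if "1 \<le> i" "i < j" "j \<le> N" for i j
    using assms(1) that orderedD by blast
  obtain M where M: "N = Suc M" "1 \<le> M" using N_ge_2 by (cases N) auto
  have "W > 0" using less[of 1 N] N_ge_2 by (simp add: W_def)
  have a_mono: "a r' \<le> a r" if "0 < r" "r \<le> r'" "r' \<le> W" for r r'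
    using repulsion_slope_ge[OF s_pos that] by (simp add: a_def c_def)
  have a_nonneg: "0 \<le> a r" if "0 < r" "r \<le> W" for r
    using a_mono[OF that] by (simp add: a_def R_def)
  have le_W: "p j - p i \<le> W" if "1 \<le> i" "i < j" "j \<le> N" for i j
    using less[of 1 i] less[of j N] that by (cases "i = 1"; cases "j = N") (auto simp: W_def)
  have "(\<Sum>j=2..N. \<zeta> 2 * \<zeta> j * a (p j - p 1)) \<in> {0..a (p 2 - p 1)}"
  proof (rule alternating_sum_antimono)
    fix j :: nat assume j: "2 \<le> j"
    show "0 \<le> a (p j - p 1)" if "j \<le> N"
      using j that less[of 1 j] le_W[of 1 j] by (intro a_nonneg) auto
    show "a (p (Suc j) - p 1) \<le> a (p j - p 1)" if "j < N"
      using j that less[of 1 j] less[of j "Suc j"] le_W[of 1 "Suc j"] by (intro a_mono) auto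
  qed (use N_ge_2 in \<open>auto simp: charge alternating\<close>)
  moreover have z1: "(\<Sum>j=2..N. \<zeta> j) = 0" and z2: "\<zeta> N = - \<zeta> 2"
    using alternating_sum_const[of 2 N \<zeta>] N_ge_2 assms(2) by (auto simp: charge alternating)
  \<comment> \<open>All contributions that do not depend on j are multiplied by the total charge of
    particles 2 to N, which is 0.\<close>
  have "(\<Sum>j=2..N. \<zeta> 2 * \<zeta> j * a (p j - p 1))
      = (\<Sum>j=2..N. \<zeta> 2 * \<zeta> j * repulsion s (p j - p 1)) + c * \<zeta> 2 * (\<Sum>j=2..N. \<zeta> j * p j)
        - \<zeta> 2 * (\<Sum>j=2..N. \<zeta> j) * (c * p 1 + R)"
    by (simp add: a_def sum.distrib[symmetric] sum_subtractf[symmetric] sum_distrib_left sum_distrib_right algebra_simps)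
  ultimately have "- (c * \<zeta> 2 * (\<Sum>j=2..N. \<zeta> j * p j)) \<le> (\<Sum>j=2..N. \<zeta> 2 * \<zeta> j * repulsion s (p j - p 1))"
    by (simp add: z1)
  then have first: "\<gamma> * - (c * \<zeta> 2 * (\<Sum>j=2..N. \<zeta> j * p j)) \<le> velocity p 1"
    unfolding velocity_first[OF assms(1)] using \<gamma>_pos by (intro mult_left_mono) auto
  have "(\<Sum>i=1..M. \<zeta> M * \<zeta> i * a (p N - p i)) \<in> {0..a (p N - p M)}"
  proof (rule alternating_sum_mono)
    fix j :: nat assume j: "1 \<le> j"
    show "0 \<le> a (p N - p j)" if "j \<le> M"
      using j that less[of j N] le_W[of j N] M by (intro a_nonneg) auto
    show "a (p N - p j) \<le> a (p N - p (Suc j))" if "j < M"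
      using j that less[of "Suc j" N] less[of j "Suc j"] le_W[of j N] M by (intro a_mono) auto
  qed (use M in \<open>auto simp: charge alternating\<close>)
  moreover have z3: "(\<Sum>i=1..M. \<zeta> i) = 0"
    using alternating_sum_const[of 1 M \<zeta>] M assms(2) by (auto simp: charge alternating)
  have "(\<Sum>i=1..M. \<zeta> M * \<zeta> i * a (p N - p i))
      = (\<Sum>i=1..M. \<zeta> M * \<zeta> i * repulsion s (p N - p i)) - c * \<zeta> M * (\<Sum>i=1..M. \<zeta> i * p i)
        + \<zeta> M * (\<Sum>i=1..M. \<zeta> i) * (c * p N - R)"
    by (simp add: a_def sum.distrib[symmetric] sum_subtractf[symmetric] sum_distrib_left sum_distrib_right algebra_simps)
  ultimately have "c * \<zeta> M * (\<Sum>i=1..M. \<zeta> i * p i) \<le> (\<Sum>i=1..M. \<zeta> M * \<zeta> i * repulsion s (p N - p i))"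
    unfolding z3 by simp
  then have "\<gamma> * (c * \<zeta> M * (\<Sum>i=1..M. \<zeta> i * p i)) \<le> \<gamma> * (\<Sum>i=1..M. \<zeta> M * \<zeta> i * repulsion s (p N - p i))"
    using \<gamma>_pos by (intro mult_left_mono) auto
  with velocity_last[OF assms(1)] have "velocity p N \<le> - (\<gamma> * (c * \<zeta> M * (\<Sum>i=1..M. \<zeta> i * p i)))" by (simp add: M)
  \<comment> \<open>Equal leading charges give both linear sums the same coefficient, so the
    interior particles cancel in their difference and only the two ends remain.\<close>
  moreover have "\<zeta> M = \<zeta> 2"
    using z2 alternating[of M] M by simp
  ultimately have "velocity p N - velocity p 1 \<le> \<gamma> * c * (\<zeta> 2 * ((\<Sum>j=2..N. \<zeta> j * p j) - (\<Sum>i=1..M. \<zeta> i * p i)))"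
    using first by (simp add: algebra_simps)
  also have "(\<Sum>j=2..N. \<zeta> j * p j) - (\<Sum>i=1..M. \<zeta> i * p i) = \<zeta> N * p N - \<zeta> 1 * p 1"
  proof -
    have "\<zeta> 1 * p 1 + (\<Sum>j=2..N. \<zeta> j * p j) = (\<Sum>j=1..N. \<zeta> j * p j)"
      using sum.atLeast_Suc_atMost[of 1 N "\<lambda>j. \<zeta> j * p j"] N_ge_2 by (simp add: numeral_2_eq_2)
    also have "\<dots> = (\<Sum>j=1..M. \<zeta> j * p j) + \<zeta> N * p N"
      by (simp add: M)
    finally show ?thesis by linarith
  qed
  also have "\<zeta> 2 * (\<zeta> N * p N - \<zeta> 1 * p 1) = - ((\<zeta> 2 * \<zeta> 2) * W)"
    using z2 alternating[of 1] N_ge_2 by (simp add: W_def numeral_2_eq_2 algebra_simps)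
  also have "\<dots> = - W" using charge[of 2] N_ge_2 by simp
  also have "\<gamma> * c * - W = - \<gamma> * W powr - (2 * s)"
    using \<open>W > 0\<close> by (simp add: c_def powr_diff)
  finally show ?thesis by (simp add: W_def)
qed

end

section \<open>Collisions\<close>

lemma convergent_at_left_of_mono_bounded:
  fixes f :: "real \<Rightarrow> real"
  assumes "a < T" and mono: "\<And>t u. a \<le> t \<Longrightarrow> t \<le> u \<Longrightarrow> u < T \<Longrightarrow> f t \<le> f u"
    and bd: "\<And>t. a \<le> t \<Longrightarrow> t < T \<Longrightarrow> f t \<le> B"
  obtains l where "(f \<longlongrightarrow> l) (at_left T)"
proof (rule that, rule increasing_tendsto)
  have bdd: "bdd_above (f ` {a..<T})" by (rule bdd_aboveI[of _ B]) (use bd in auto)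
  have ev: "eventually (\<lambda>t. b < t \<and> t < T) (at_left T)" if "b < T" for b
    using that eventually_at_left_real[OF that] by (auto elim: eventually_mono)
  show "eventually (\<lambda>t. f t \<le> (SUP t\<in>{a..<T}. f t)) (at_left T)"
    using ev[OF \<open>a < T\<close>] by eventually_elim (auto intro!: cSUP_upper bdd)
  fix y assume "y < (SUP t\<in>{a..<T}. f t)"
  then obtain t where t: "t \<in> {a..<T}" "y < f t"
    using less_cSUP_iff[OF _ bdd] \<open>a < T\<close> by auto
  then have "t < T" by simp
  from ev[OF this] show "eventually (\<lambda>u. y < f u) (at_left T)"
    by eventually_elim (rule less_le_trans[OF t(2) mono], use t in auto)
qed

section \<open>Order, monotone sums and the shrinking width along a solution\<close>

context alternating_charges
begin

abbreviation solution :: "(nat \<Rightarrow> real) \<Rightarrow> ereal \<Rightarrow> (nat \<Rightarrow> real \<Rightarrow> real) \<Rightarrow> bool" where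
  "solution \<equiv> particle_solution s \<gamma> N \<zeta>"

lemma solution_init: "solution x0 T x \<Longrightarrow> 1 \<le> i \<Longrightarrow> i \<le> N \<Longrightarrow> x i 0 = x0 i"
  by (auto simp: particle_solution_def)

lemma solution_continuous:
  assumes "solution x0 T x" "1 \<le> i" "i \<le> N" "0 \<le> a" "ereal b < T"
  shows "continuous_on {a..b} (x i)"
  by (rule continuous_on_subset[of "{t. 0 \<le> t \<and> ereal t < T}"])
    (use assms in \<open>auto simp: particle_solution_def intro: le_less_trans[of "ereal _" "ereal b"]\<close>)

lemma solution_deriv:
  assumes "solution x0 T x" "1 \<le> i" "i \<le> N" "0 < t" "ereal t < T"
  shows "(x i has_real_derivative velocity (\<lambda>j. x j t) i) (at t)"
  using assms by (auto simp: particle_solution_def)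

text \<open>By the intermediate value theorem two particles cannot change order without
  meeting.\<close>

lemma solution_ordered:
  assumes sol: "solution x0 T x" and ord: "ordered x0" and t: "0 \<le> t" "ereal t < T"
  shows "ordered (\<lambda>i. x i t)"
  unfolding ordered_def
proof (intro ballI impI)
  fix i j assume ij: "i \<in> {1..N}" "j \<in> {1..N}" "i < j"
  have neq: "x j r - x i r \<noteq> 0" if "0 \<le> r" "r \<le> t" for r
  proof -
    have "ereal r < T" using that t by (metis ereal_less_eq(3) le_less_trans)
    then have "x i r \<noteq> x j r"
      using sol ij that unfolding particle_solution_def by (metis less_irrefl)
    then show ?thesis by simp
  qed
  have cont: "continuous_on {0..t} (\<lambda>r. x j r - x i r)"
    using solution_continuous[OF sol _ _ order.refl t(2)] ij by (intro continuous_on_diff) auto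
  have "x j 0 - x i 0 > 0"
    using solution_init[OF sol] ij orderedD[OF ord, of i j] by simp
  then have "\<not> x j t - x i t \<le> 0"
    using IVT2'[of "\<lambda>r. x j r - x i r" t 0 0] cont neq t by force
  then show "x i t < x j t" by simp
qed

lemma solution_partial_sum_mono:
  assumes sol: "solution x0 T x" and ord: "ordered x0" and k: "k \<le> N"
    and t: "0 \<le> t" "t \<le> r" "ereal r < T"
  shows "(\<Sum>i=1..k. x i t) \<le> (\<Sum>i=1..k. x i r)"
proof (rule DERIV_nonneg_imp_increasing_open[OF \<open>t \<le> r\<close>])
  fix u assume u: "t < u" "u < r"
  then have u': "0 < u" "ereal u < T"
    using t by (auto intro: less_trans[of "ereal u" "ereal r"])
  have "((\<lambda>t. \<Sum>i=1..k. x i t) has_real_derivative (\<Sum>i=1..k. velocity (\<lambda>j. x j u) i)) (at u)"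
    by (intro DERIV_sum solution_deriv[OF sol]) (use k u' in auto)
  moreover have "0 \<le> (\<Sum>i=1..k. velocity (\<lambda>j. x j u) i)"
    using sum_velocity_nonneg[OF solution_ordered[OF sol ord] k] u' by simp
  ultimately show "\<exists>y. ((\<lambda>t. \<Sum>i=1..k. x i t) has_real_derivative y) (at u) \<and> 0 \<le> y" by blast
next
  show "continuous_on {t..r} (\<lambda>t. \<Sum>i=1..k. x i t)"
    by (intro continuous_on_sum solution_continuous[OF sol]) (use k t in auto)
qed

lemma solution_total_sum:
  assumes sol: "solution x0 T x" and t: "0 \<le> t" "ereal t < T"
  shows "(\<Sum>i=1..N. x i t) = (\<Sum>i=1..N. x i 0)"
proof (cases "t = 0")
  case False
  show ?thesis
  proof (rule DERIV_isconst_end[where f = "\<lambda>t. \<Sum>i=1..N. x i t"])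
    show "0 < t" using False t by simp
    show "continuous_on {0..t} (\<lambda>t. \<Sum>i=1..N. x i t)"
      by (intro continuous_on_sum solution_continuous[OF sol]) (use t in auto)
    fix u assume u: "0 < u" "u < t"
    then have "ereal u < T" using t by (auto intro: less_trans[of "ereal u" "ereal t"])
    then have "((\<lambda>t. \<Sum>i=1..N. x i t) has_real_derivative (\<Sum>i=1..N. velocity (\<lambda>j. x j u) i)) (at u)"
      by (intro DERIV_sum solution_deriv[OF sol]) (use u in auto)
    then show "((\<lambda>t. \<Sum>i=1..N. x i t) has_real_derivative 0) (at u)"
      using sum_velocity[of N "\<lambda>j. x j u"] by simp
  qed
qed simp

text \<open>The total is conserved, so what the first N - 1 particles gain together the last one
  loses. By the ordering this bounds all particles from above.\<close>

lemma solution_last_le: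
  assumes sol: "solution x0 T x" and ord: "ordered x0" and t: "0 \<le> t" "ereal t < T"
  shows "x N t \<le> x0 N"
proof -
  obtain M where M: "N = Suc M" using N_ge_2 by (cases N) auto
  have "(\<Sum>i=1..M. x i 0) \<le> (\<Sum>i=1..M. x i t)"
    by (rule solution_partial_sum_mono[OF sol ord]) (use t M in auto)
  then have "x N t \<le> x N 0" using solution_total_sum[OF sol t] by (simp add: M)
  then show ?thesis using solution_init[OF sol, of N] N_ge_2 by simp
qed

lemma solution_tendsto:
  assumes sol: "solution x0 (ereal T) x" and ord: "ordered x0"
  obtains l where "\<And>i. 1 \<le> i \<Longrightarrow> i \<le> N \<Longrightarrow> (x i \<longlongrightarrow> l i) (at_left T)"
proof -
  have "0 < T" using sol by (simp add: particle_solution_def)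
  have le: "x i t \<le> x0 N" if "1 \<le> i" "i \<le> N" "0 \<le> t" "t < T" for i t
    using solution_last_le[OF sol ord, of t] orderedD[OF solution_ordered[OF sol ord, of t], of i N] that
    by (cases "i = N") auto
  have "\<exists>m. ((\<lambda>t. \<Sum>i=1..k. x i t) \<longlongrightarrow> m) (at_left T)" if "k \<le> N" for k
  proof (rule convergent_at_left_of_mono_bounded[OF \<open>0 < T\<close>])
    show "(\<Sum>i=1..k. x i t) \<le> (\<Sum>i=1..k. x i u)" if "0 \<le> t" "t \<le> u" "u < T" for t u
      using solution_partial_sum_mono[OF sol ord \<open>k \<le> N\<close>] that by simp
    show "(\<Sum>i=1..k. x i t) \<le> (\<Sum>i=1..k. x0 N)" if "0 \<le> t" "t < T" for t
      using le that \<open>k \<le> N\<close> by (intro sum_mono) auto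
  qed blast
  then obtain m where m: "\<And>k. k \<le> N \<Longrightarrow> ((\<lambda>t. \<Sum>i=1..k. x i t) \<longlongrightarrow> m k) (at_left T)"
    by metis
  \<comment> \<open>Each position is the difference of two consecutive partial sums; the empty sum k
    = 0 covers the first particle.\<close>
  have "(x i \<longlongrightarrow> m i - m (i - 1)) (at_left T)" if i: "1 \<le> i" "i \<le> N" for i
  proof -
    obtain k where k: "i = Suc k" using i by (cases i) auto
    have "((\<lambda>t. (\<Sum>i=1..i. x i t) - (\<Sum>i=1..k. x i t)) \<longlongrightarrow> m i - m k) (at_left T)"
      using i k by (intro tendsto_diff m) auto
    then show ?thesis by (simp add: k)
  qed
  then show thesis by (rule that)
qed

text \<open>Multiplication by w^(2s) turns w' \<le> -\<kappa> w^(-2s) into a bound on the derivative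
  of w^(2s+1), so \<open>E\<close> is nonincreasing. Since the power is nonnegative, (2s+1) \<kappa>
  t \<le> E t \<le> E 0.\<close>

lemma solution_time_le:
  assumes sol: "solution x0 T x" and ord: "ordered x0" and "0 < \<kappa>" and t: "0 \<le> t" "ereal t < T"
    and shrink: "\<And>p. ordered p \<Longrightarrow> velocity p N - velocity p 1 \<le> - \<kappa> * (p N - p 1) powr - (2 * s)"
  shows "t \<le> (x0 N - x0 1) powr (2 * s + 1) / ((2 * s + 1) * \<kappa>)"
proof -
  define E where "E r = (x N r - x 1 r) powr (2 * s + 1) + (2 * s + 1) * \<kappa> * r" for r
  have w_pos: "0 < x N r - x 1 r" if "0 \<le> r" "r \<le> t" for r
  proof -
    have "ereal r < T" using that t by (metis ereal_less_eq(3) le_less_trans)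
    then show ?thesis using orderedD[OF solution_ordered[OF sol ord that(1)], of 1 N] N_ge_2 by simp
  qed
  have "E t \<le> E 0"
  proof (rule DERIV_nonpos_imp_decreasing_open[OF \<open>0 \<le> t\<close>])
    fix r assume r: "0 < r" "r < t"
    then have rT: "ereal r < T" using t by (auto intro: less_trans[of "ereal r" "ereal t"])
    define w where "w = x N r - x 1 r"
    define v where "v = velocity (\<lambda>j. x j r) N - velocity (\<lambda>j. x j r) 1"
    have "w > 0" using w_pos[of r] r by (simp add: w_def)
    have D: "((\<lambda>r. x N r - x 1 r) has_real_derivative v) (at r)"
      unfolding v_def using r rT N_ge_2 by (intro DERIV_diff solution_deriv[OF sol]) auto
    have "(E has_real_derivative (2 * s + 1) * w powr (2 * s) * v + (2 * s + 1) * \<kappa>) (at r)"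
    proof -
      have "((\<lambda>z. z powr (2 * s + 1)) has_real_derivative (2 * s + 1) * w powr (2 * s)) (at w)"
        using has_real_derivative_powr[OF \<open>w > 0\<close>, of "2 * s + 1"] by simp
      then show ?thesis
        unfolding E_def[abs_def] w_def by (intro DERIV_add DERIV_cmult_Id DERIV_chain2[OF _ D])
    qed
    moreover have "v \<le> - \<kappa> * w powr - (2 * s)"
      unfolding v_def w_def using r rT by (intro shrink solution_ordered[OF sol ord]) auto
    then have "w powr (2 * s) * v \<le> w powr (2 * s) * (- \<kappa> * w powr - (2 * s))"
      by (rule mult_left_mono) simp
    then have "w powr (2 * s) * v \<le> - \<kappa>"
      using \<open>w > 0\<close> by (simp add: powr_minus field_simps)
    then have "(2 * s + 1) * (w powr (2 * s) * v) \<le> (2 * s + 1) * (- \<kappa>)"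
      using s_pos by (intro mult_left_mono) auto
    ultimately show "\<exists>y. (E has_real_derivative y) (at r) \<and> y \<le> 0"
      by (intro exI conjI) (auto simp: mult.assoc)
  next
    have "x N r \<noteq> x 1 r" if "0 \<le> r" "r \<le> t" for r
      using w_pos[OF that] by simp
    then show "continuous_on {0..t} E"
      unfolding E_def
      by (intro continuous_intros solution_continuous[OF sol])
        (use t N_ge_2 in auto)
  qed
  moreover have "0 \<le> (x N t - x 1 t) powr (2 * s + 1)" by simp
  moreover have "x N 0 = x0 N" "x 1 0 = x0 1"
    using solution_init[OF sol] N_ge_2 by auto
  ultimately have "(2 * s + 1) * \<kappa> * t \<le> (x0 N - x0 1) powr (2 * s + 1)"
    unfolding E_def by (smt (verit) mult_zero_right)
  then show ?thesis
    using s_pos \<open>0 < \<kappa>\<close> by (simp add: pos_le_divide_eq mult.commute)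
qed

section \<open>Continuation past a time with distinct limits\<close>

text \<open>The inequality is strict in order that the same \<delta>, later the truncation level,
  survives small changes of time.\<close>

lemma ordered_gap:
  assumes "ordered p"
  obtains \<delta> where "0 < \<delta>" and "\<And>i j. 1 \<le> i \<Longrightarrow> i < j \<Longrightarrow> j \<le> N \<Longrightarrow> \<delta> < p j - p i"
proof -
  define S where "S = {ij \<in> {1..N} \<times> {1..N}. fst ij < snd ij}"
  have "eventually (\<lambda>\<delta>. \<forall>ij\<in>S. \<delta> < p (snd ij) - p (fst ij)) (at_right 0)"
  proof (rule eventually_ball_finite, safe)
    show "finite S" by (simp add: S_def)
    fix i j assume "(i, j) \<in> S"
    then have "0 < p j - p i" using orderedD[OF assms] by (auto simp: S_def)
    from eventually_at_right_real[OF this]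
    show "eventually (\<lambda>\<delta>. \<delta> < p (snd (i, j)) - p (fst (i, j))) (at_right 0)"
      by (auto elim: eventually_mono)
  qed
  then have "eventually (\<lambda>\<delta>. 0 < \<delta> \<and> (\<forall>ij\<in>S. \<delta> < p (snd ij) - p (fst ij))) (at_right 0)"
    using eventually_at_right_less by (rule eventually_conj[rotated])
  then obtain \<delta> where "0 < \<delta>" "\<forall>ij\<in>S. \<delta> < p (snd ij) - p (fst ij)"
    using eventually_happens'[OF trivial_limit_at_right_real] by blast
  then show thesis by (intro that[of \<delta>]) (auto simp: S_def)
qed

lemma eventually_gap:
  fixes y :: "nat \<Rightarrow> real \<Rightarrow> real"
  assumes "\<And>i. 1 \<le> i \<Longrightarrow> i \<le> N \<Longrightarrow> isCont (y i) T"
    and gap: "\<And>i j. 1 \<le> i \<Longrightarrow> i < j \<Longrightarrow> j \<le> N \<Longrightarrow> \<delta> < y j T - y i T"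
  obtains d where "0 < d" and "\<And>i j t. 1 \<le> i \<Longrightarrow> i < j \<Longrightarrow> j \<le> N \<Longrightarrow> \<bar>t - T\<bar> < d \<Longrightarrow> \<delta> < y j t - y i t"
proof -
  define S where "S = {ij \<in> {1..N} \<times> {1..N}. fst ij < snd ij}"
  have "eventually (\<lambda>t. \<forall>ij\<in>S. \<delta> < y (snd ij) t - y (fst ij) t) (nhds T)"
  proof (rule eventually_ball_finite, safe)
    show "finite S" by (simp add: S_def)
    fix i j assume "(i, j) \<in> S"
    then have "isCont (\<lambda>t. y j t - y i t) T" "\<delta> < y j T - y i T"
      using assms(1)[of i] assms(1)[of j] gap[of i j] by (auto simp: S_def intro!: isCont_diff)
    moreover from this have "((\<lambda>t. y j t - y i t) \<longlongrightarrow> y j T - y i T) (nhds T)"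
      using tendsto_at_iff_tendsto_nhds[of "\<lambda>t. y j t - y i t" T] by (simp add: isCont_def)
    ultimately show "eventually (\<lambda>t. \<delta> < y (snd (i, j)) t - y (fst (i, j)) t) (nhds T)"
      by (simp add: order_tendstoD(1))
  qed
  then obtain d where "0 < d" "\<And>t. \<bar>t - T\<bar> < d \<Longrightarrow> \<forall>ij\<in>S. \<delta> < y (snd ij) t - y (fst ij) t"
    unfolding eventually_nhds_metric dist_real_def by blast
  then show thesis by (intro that[of d]) (auto simp: S_def)
qed

(* Freezing the force below distance \<delta> makes the vector field globally Lipschitz. The order of the
   indices rather than of the positions fixes the direction, so that it is also continuous. *)
definition truncated_force :: "real \<Rightarrow> (nat \<Rightarrow> real) \<Rightarrow> nat \<Rightarrow> nat \<Rightarrow> real" where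
  "truncated_force \<delta> p i j = (if j = i then 0 else \<zeta> i * \<zeta> j *
     (if j < i then repulsion s (max (p i - p j) \<delta>) else - repulsion s (max (p j - p i) \<delta>)))"

definition truncated_velocity :: "real \<Rightarrow> nat \<Rightarrow> (nat \<Rightarrow> real) \<Rightarrow> real" where
  "truncated_velocity \<delta> i p = \<gamma> * (\<Sum>j\<in>{1..N}. truncated_force \<delta> p i j)"

lemma truncated_velocity_eq:
  assumes "0 < \<delta>" and gap: "\<And>i j. 1 \<le> i \<Longrightarrow> i < j \<Longrightarrow> j \<le> N \<Longrightarrow> \<delta> < p j - p i" and "i \<in> {1..N}"
  shows "truncated_velocity \<delta> i p = velocity p i"
proof -
  have "truncated_force \<delta> p i j = interaction p i j" if "j \<in> {1..N}" for j
  proof (cases i j rule: linorder_cases)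
    case less
    moreover have "\<delta> < p j - p i" using gap[of i j] less assms(3) that by simp
    ultimately show ?thesis
      using \<open>0 < \<delta>\<close> by (simp add: truncated_force_def interaction_greater max_def)
  next
    case greater
    moreover have "\<delta> < p i - p j" using gap[of j i] greater assms(3) that by simp
    ultimately show ?thesis
      using \<open>0 < \<delta>\<close> by (simp add: truncated_force_def interaction_less max_def)
  qed (simp add: truncated_force_def interaction_def)
  then show ?thesis by (simp add: truncated_velocity_def velocity_eq)
qed

text \<open>The constant collects the largest slope \<delta>^-(2s+1), a factor 2 because a distance
  moves with both of its particles, and N terms.\<close>

lemma truncated_velocity_Lipschitz:
  assumes "0 < \<delta>" "i \<in> {1..N}" and B: "\<And>j. j \<in> {1..N} \<Longrightarrow> \<bar>p j - q j\<bar> \<le> B"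
  shows "\<bar>truncated_velocity \<delta> i p - truncated_velocity \<delta> i q\<bar>
    \<le> \<gamma> * (real N * (\<delta> powr - (2 * s + 1) * 2)) * B"
proof -
  define c where "c = \<delta> powr - (2 * s + 1)"
  have rep: "\<bar>repulsion s (max a \<delta>) - repulsion s (max b \<delta>)\<bar> \<le> c * 2 * B" if "\<bar>a - b\<bar> \<le> 2 * B" for a b
  proof -
    have "c * \<bar>a - b\<bar> \<le> c * (2 * B)" using that by (intro mult_left_mono) (auto simp: c_def)
    then show ?thesis
      using repulsion_truncated_Lipschitz[OF s_pos assms(1), of a b] unfolding c_def[symmetric] by simp
  qed
  have B0: "0 \<le> B" using B[OF assms(2)] by simp
  have "\<bar>truncated_force \<delta> p i j - truncated_force \<delta> q i j\<bar> \<le> c * 2 * B" if j: "j \<in> {1..N}" for j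
  proof (cases "j = i")
    case True
    then show ?thesis using B0 by (simp add: truncated_force_def c_def)
  next
    case False
    have "\<zeta> i * \<zeta> i = 1" "\<zeta> j * \<zeta> j = 1" using assms j by (auto intro: charge)
    then have "\<bar>\<zeta> i * \<zeta> j\<bar> = 1" by (auto simp: square_eq_1_iff abs_mult)
    then have "\<bar>truncated_force \<delta> p i j - truncated_force \<delta> q i j\<bar> =
        (if j < i then \<bar>repulsion s (max (p i - p j) \<delta>) - repulsion s (max (q i - q j) \<delta>)\<bar>
         else \<bar>repulsion s (max (q j - q i) \<delta>) - repulsion s (max (p j - p i) \<delta>)\<bar>)"
      using False by (simp add: truncated_force_def right_diff_distrib[symmetric] abs_mult del: mult_minus_right)
    moreover have "\<bar>(p i - p j) - (q i - q j)\<bar> \<le> 2 * B" "\<bar>(q j - q i) - (p j - p i)\<bar> \<le> 2 * B"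
      using B[OF assms(2)] B[OF j] by linarith+
    ultimately show ?thesis by (auto intro!: rep)
  qed
  then have "\<bar>\<Sum>j\<in>{1..N}. truncated_force \<delta> p i j - truncated_force \<delta> q i j\<bar> \<le> (\<Sum>j\<in>{1..N}. c * 2 * B)"
    by (intro sum_abs[THEN order_trans] sum_mono)
  then have "\<gamma> * \<bar>\<Sum>j\<in>{1..N}. truncated_force \<delta> p i j - truncated_force \<delta> q i j\<bar> \<le> \<gamma> * (\<Sum>j\<in>{1..N}. c * 2 * B)"
    using \<gamma>_pos by (intro mult_left_mono) auto
  then show ?thesis
    using \<gamma>_pos unfolding c_def[symmetric]
    by (simp add: truncated_velocity_def right_diff_distrib[symmetric] sum_subtractf[symmetric] abs_mult mult_ac)
qed

text \<open>The truncated system is started at T from the limits and glued to x. Near T all gaps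
  exceed \<delta>, so truncation is invisible and the true equation holds on both sides; the
  remaining point is the derivative at T itself.\<close>

lemma solution_extends:
  assumes sol: "solution x0 (ereal T) x" and ord: "ordered x0"
    and lim: "\<And>i. 1 \<le> i \<Longrightarrow> i \<le> N \<Longrightarrow> (x i \<longlongrightarrow> l i) (at_left T)"
    and distinct: "\<And>i j. 1 \<le> i \<Longrightarrow> i < j \<Longrightarrow> j \<le> N \<Longrightarrow> l i \<noteq> l j"
  obtains T' y where "T < T'" "solution x0 (ereal T') y"
    and "\<And>i t. t < T \<Longrightarrow> y i t = x i t"
proof -
  have "0 < T" using sol by (simp add: particle_solution_def)
  have ev: "eventually (\<lambda>t. 0 < t \<and> t < T) (at_left T)"
    using eventually_at_left_real[OF \<open>0 < T\<close>] by (auto elim: eventually_mono)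
  have ordl: "ordered l"
    unfolding ordered_def
  proof (intro ballI impI)
    fix i j assume ij: "i \<in> {1..N}" "j \<in> {1..N}" "i < j"
    have "eventually (\<lambda>t. x i t \<le> x j t) (at_left T)"
      using ev by eventually_elim
        (use orderedD[OF solution_ordered[OF sol ord]] ij in \<open>auto intro!: less_imp_le\<close>)
    then have "l i \<le> l j"
      using lim ij by (intro tendsto_le[OF trivial_limit_at_left_real]) auto
    then show "l i < l j" using distinct[of i j] ij by simp
  qed
  obtain \<delta> where \<delta>: "0 < \<delta>" and gapl: "\<And>i j. 1 \<le> i \<Longrightarrow> i < j \<Longrightarrow> j \<le> N \<Longrightarrow> \<delta> < l j - l i"
    using ordered_gap[OF ordl] by blast
  define L where "L = \<gamma> * (real N * (\<delta> powr - (2 * s + 1) * 2))"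
  have L: "0 \<le> L" using \<gamma>_pos by (simp add: L_def)
  have lip: "\<bar>truncated_velocity \<delta> i p - truncated_velocity \<delta> i q\<bar> \<le> L * B"
    if "i \<in> {1..N}" "\<And>j. j \<in> {1..N} \<Longrightarrow> \<bar>p j - q j\<bar> \<le> B" for i p q B
    unfolding L_def by (rule truncated_velocity_Lipschitz[OF \<delta> that])
  obtain \<tau> w where \<tau>: "0 < \<tau>" and w0: "\<And>i. i \<in> {1..N} \<Longrightarrow> w i T = l i"
    and w_cont: "\<And>i. i \<in> {1..N} \<Longrightarrow> continuous_on UNIV (w i)"
    and w_deriv: "\<And>i t. i \<in> {1..N} \<Longrightarrow> T < t \<Longrightarrow> t < T + \<tau> \<Longrightarrow>
        (w i has_real_derivative truncated_velocity \<delta> i (\<lambda>j. w j t)) (at t)"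
    using Picard_finite_system[of "{1..N}" L "truncated_velocity \<delta>" T l, OF finite_atLeastAtMost L lip]
    by blast
  define y where "y i t = (if t < T then x i t else w i t)" for i t
  have near_left: "eventually (\<lambda>r. y i r = x i r) (nhds t)" if "t < T" for i t
    using eventually_nhds_in_open[of "{..<T}" t] that by (auto simp: y_def elim: eventually_mono)
  have near_right: "eventually (\<lambda>r. y i r = w i r) (nhds t)" if "T < t" for i t
    using eventually_nhds_in_open[of "{T<..}" t] that by (auto simp: y_def elim: eventually_mono)
  have y_left: "(y i has_real_derivative D) (at t) \<longleftrightarrow> (x i has_real_derivative D) (at t)" if "t < T" for i t D
    using near_left[OF that] that by (intro DERIV_cong_ev) auto
  have y_right: "(y i has_real_derivative D) (at t) \<longleftrightarrow> (w i has_real_derivative D) (at t)" if "T < t" for i t D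
    using near_right[OF that] that by (intro DERIV_cong_ev) auto
  have y_T: "isCont (y i) T" if "1 \<le> i" "i \<le> N" for i
  proof -
    have "(y i \<longlongrightarrow> l i) (at_left T)"
      by (rule Lim_transform_eventually[OF lim[OF that]]) (use ev in \<open>auto simp: y_def elim: eventually_mono\<close>)
    moreover have "(w i \<longlongrightarrow> w i T) (at_right T)"
      using w_cont[of i] that by (auto simp: continuous_on_def intro: tendsto_within_subset)
    then have "(y i \<longlongrightarrow> w i T) (at_right T)"
      by (rule Lim_transform_eventually) (auto simp: y_def eventually_at_right_field intro!: exI[of _ "T + 1"])
    ultimately show ?thesis
      using w0[of i] that by (simp add: isCont_def y_def filterlim_split_at)
  qed
  have gap_T: "\<delta> < y j T - y i T" if "1 \<le> i" "i < j" "j \<le> N" for i j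
    using gapl[OF that] w0 that by (simp add: y_def)
  obtain d where d: "0 < d"
    and gap: "\<And>i j t. 1 \<le> i \<Longrightarrow> i < j \<Longrightarrow> j \<le> N \<Longrightarrow> \<bar>t - T\<bar> < d \<Longrightarrow> \<delta> < y j t - y i t"
    using eventually_gap[where y = y and T = T and \<delta> = \<delta>, OF y_T gap_T] by blast
  \<comment> \<open>This stays within the gap estimate and the Picard interval; e < T keeps the left
    neighbourhood of T at positive times, and halving makes the bounds strict.\<close>
  define e where "e = min (min d \<tau>) T / 2"
  have e: "0 < e" "e < d" "e < \<tau>" "e < T"
    using d \<tau> \<open>0 < T\<close> by (auto simp: e_def min_def)
  have vel: "truncated_velocity \<delta> i (\<lambda>j. y j t) = velocity (\<lambda>j. y j t) i" if "i \<in> {1..N}" "\<bar>t - T\<bar> < d" for i t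
    using gap that by (intro truncated_velocity_eq[OF \<delta>]) auto
  have deriv_left: "(y i has_real_derivative velocity (\<lambda>j. y j t) i) (at t)" if "i \<in> {1..N}" "0 < t" "t < T" for i t
    using solution_deriv[OF sol, of i t] that y_left[OF that(3)] by (simp add: y_def)
  have deriv_right: "(y i has_real_derivative velocity (\<lambda>j. y j t) i) (at t)" if "i \<in> {1..N}" "T < t" "t < T + e" for i t
  proof -
    have "(\<lambda>j. y j t) = (\<lambda>j. w j t)" using that by (auto simp: y_def)
    then show ?thesis
      using w_deriv[OF that(1,2)] vel[OF that(1), of t] that e y_right[OF that(2)] by simp
  qed
  have y_cont: "isCont (y i) t" if "i \<in> {1..N}" "0 < t" "t < T + e" for i t
    using DERIV_isCont[OF deriv_left[OF that(1,2)]] DERIV_isCont[OF deriv_right[OF that(1) _ that(3)]] y_T[of i] that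
    by (cases t T rule: linorder_cases) auto
  have deriv_T: "(y i has_real_derivative velocity (\<lambda>j. y j T) i) (at T)" if i: "i \<in> {1..N}" for i
  proof -
    define h where "h = e / 2"
    have h: "0 < h" "h < e" using e by (auto simp: h_def)
    have cont: "continuous_on {T - h..T + h} (y j)" if "j \<in> {1..N}" for j
      using y_cont[OF that] h e by (intro continuous_at_imp_continuous_on) auto
    \<comment> \<open>The truncated velocity is used because it is continuous along y through T, as
      the removal of the singularity requires.\<close>
    have "(y i has_real_derivative truncated_velocity \<delta> i (\<lambda>j. y j T)) (at T)"
    proof (rule has_real_derivative_remove_singularity)
      show "T \<in> {T - h<..<T + h}" using h by simp
      show "continuous_on {T - h..T + h} (y i)" by (rule cont[OF i])
      show "continuous_on {T - h..T + h} (\<lambda>t. truncated_velocity \<delta> i (\<lambda>j. y j t))"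
        by (rule continuous_on_sup_Lipschitz[OF finite_atLeastAtMost[of 1 N] lip[OF i] cont])
      fix t assume t: "t \<in> {T - h<..<T + h} - {T}"
      then show "(y i has_real_derivative truncated_velocity \<delta> i (\<lambda>j. y j t)) (at t)"
        using deriv_left[OF i, of t] deriv_right[OF i, of t] vel[OF i, of t] h e by (cases "t < T") auto
    qed
    then show ?thesis using vel[OF i, of T] d by simp
  qed
  have "solution x0 (ereal (T + e)) y"
    unfolding particle_solution_def
  proof (intro conjI allI impI ballI)
    show "0 < ereal (T + e)" using \<open>0 < T\<close> e by simp
    fix i assume i: "i \<in> {1..N}"
    show "y i 0 = x0 i" using solution_init[OF sol, of i] i \<open>0 < T\<close> by (simp add: y_def)
    show "continuous_on {t. 0 \<le> t \<and> ereal t < ereal (T + e)} (y i)"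
      unfolding continuous_on_eq_continuous_within
    proof
      fix t assume "t \<in> {t. 0 \<le> t \<and> ereal t < ereal (T + e)}"
      then have t: "0 \<le> t" "t < T + e" by auto
      show "continuous (at t within {t. 0 \<le> t \<and> ereal t < ereal (T + e)}) (y i)"
      \<comment> \<open>At time 0 no derivative is available, and continuity from the right is
        inherited from x.\<close>
      proof (cases "t = 0")
        case True
        have "continuous_on {0..T/2} (x i)"
          using solution_continuous[OF sol, of i 0 "T / 2"] i \<open>0 < T\<close> by auto
        then have "continuous_on {0..T/2} (y i)"
          by (rule continuous_on_eq) (use \<open>0 < T\<close> in \<open>auto simp: y_def\<close>)
        then have "continuous (at 0 within {0..T/2}) (y i)"
          using \<open>0 < T\<close> by (simp add: continuous_on_eq_continuous_within)
        moreover have "at 0 within {0..T/2} = at 0 within {t. 0 \<le> t \<and> ereal t < ereal (T + e)}"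
          by (rule at_within_nhd[of _ "{..<T/2}"]) (use \<open>0 < T\<close> e in auto)
        ultimately show ?thesis using True by simp
      next
        case False
        then have "isCont (y i) t"
          using y_cont[OF i, of t] t by simp
        then show ?thesis
          by (rule continuous_at_imp_continuous_at_within)
      qed
    qed
  next
    fix t i j assume t: "0 \<le> t \<and> ereal t < ereal (T + e)" and ij: "i \<in> {1..N}" "j \<in> {1..N}" "i \<noteq> j"
    show "y i t \<noteq> y j t"
    proof (cases "t < T")
      case True
      then have "x i t \<noteq> x j t"
        using sol t ij unfolding particle_solution_def by simp
      then show ?thesis using True by (simp add: y_def)
    next
      case False
      then have "\<bar>t - T\<bar> < d" using t e by simp
      then show ?thesis
        using gap[of i j t] gap[of j i t] ij \<delta> by (cases i j rule: linorder_cases) auto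
    qed
  next
    fix t i assume t: "0 < t \<and> ereal t < ereal (T + e)" and i: "i \<in> {1..N}"
    then show "(y i has_real_derivative velocity (\<lambda>j. y j t) i) (at t)"
      using deriv_left[OF i, of t] deriv_right[OF i, of t] deriv_T[OF i]
      by (cases t T rule: linorder_cases) simp_all
  qed
  then show thesis
    by (rule that[rotated]) (use e in \<open>auto simp: y_def\<close>)
qed

section \<open>The collision time and its bound\<close>

lemma maximal_solution_collides:
  assumes max: "maximal_particle_solution s \<gamma> N \<zeta> x0 (ereal T) x" and ord: "ordered x0"
  shows "collision_at N x T"
proof (rule ccontr)
  assume no: "\<not> collision_at N x T"
  have sol: "solution x0 (ereal T) x"
    using max by (simp add: maximal_particle_solution_def)
  obtain l where l: "\<And>i. 1 \<le> i \<Longrightarrow> i \<le> N \<Longrightarrow> (x i \<longlongrightarrow> l i) (at_left T)"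
    using solution_tendsto[OF sol ord] by blast
  have "l i \<noteq> l j" if "1 \<le> i" "i < j" "j \<le> N" for i j
  proof
    assume "l i = l j"
    then have "collision_at N x T"
      unfolding collision_at_def using l[of i] l[of j] that
      by (intro bexI[of _ i] bexI[of _ j] conjI exI[of _ "l i"]) auto
    with no show False by contradiction
  qed
  then obtain T' y where "T < T'" "solution x0 (ereal T') y" "\<And>i t. t < T \<Longrightarrow> y i t = x i t"
    using solution_extends[OF sol ord l] by blast
  with max show False
    unfolding maximal_particle_solution_def by (metis less_ereal.simps(1))
qed

lemma maximal_solution_finite_collision:
  assumes max: "maximal_particle_solution s \<gamma> N \<zeta> x0 Tc x" and ord: "ordered x0" and "0 < \<kappa>"
    and shrink: "\<And>p. ordered p \<Longrightarrow> velocity p N - velocity p 1 \<le> - \<kappa> * (p N - p 1) powr - (2 * s)"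
  shows "\<exists>T. Tc = ereal T \<and> collision_at N x T \<and> T \<le> (x0 N - x0 1) powr (2 * s + 1) / ((2 * s + 1) * \<kappa>)"
proof -
  define B where "B = (x0 N - x0 1) powr (2 * s + 1) / ((2 * s + 1) * \<kappa>)"
  have sol: "solution x0 Tc x"
    using max by (simp add: maximal_particle_solution_def)
  then have "0 < Tc" by (simp add: particle_solution_def)
  have "Tc \<le> ereal B"
  proof (rule ccontr)
    assume "\<not> Tc \<le> ereal B"
    \<comment> \<open>A time strictly between the bound and \<open>Tc\<close> still belongs to the
      existence interval; this also rules out an infinite \<open>Tc\<close>.\<close>
    then obtain t where t: "ereal B < ereal t" "ereal t < Tc"
      using ereal_dense2[of "ereal B" Tc] unfolding not_le by blast
    have "0 \<le> B" using s_pos \<open>0 < \<kappa>\<close> by (simp add: B_def)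
    then have "0 \<le> t" using t by simp
    then have "t \<le> B"
      unfolding B_def using t(2) by (rule solution_time_le[OF sol ord \<open>0 < \<kappa>\<close> _ _ shrink])
    then show False using t by simp
  qed
  then obtain T where T: "Tc = ereal T" "T \<le> B"
    using \<open>0 < Tc\<close> by (cases Tc) auto
  then show ?thesis
    using maximal_solution_collides[OF max[unfolded T] ord] by (auto simp: B_def)
qed

end

theorem theorem1p6:
  fixes s \<alpha> \<gamma> :: real and N :: nat and W u :: "real \<Rightarrow> real"
    and \<zeta> x0 :: "nat \<Rightarrow> real" and x :: "nat \<Rightarrow> real \<Rightarrow> real" and Tc :: ereal
  assumes "0 < s" "s < 1" and "0 < \<alpha>" "\<alpha> < 1" and "N \<ge> 2"
    and "multiwell_potential \<alpha> W"
    and "layer_solution s W u"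
    and "\<gamma> = layer_gamma u"
    and "\<forall>i\<in>{1..<N}. x0 i < x0 (i + 1)"
    and "\<forall>i\<in>{1..N}. \<zeta> i \<in> {-1, 1}"
    and "\<forall>i\<in>{1..<N}. \<zeta> i * \<zeta> (i + 1) = -1"
    and "maximal_particle_solution s \<gamma> N \<zeta> x0 Tc x"
  shows "\<exists>T. Tc = ereal T \<and> collision_at N x T \<and>
      (odd N \<longrightarrow> T \<le> (real N - 1) * (x0 N - x0 1) powr (2 * s + 1) / ((2 * s + 1) * \<gamma>)) \<and>
      (even N \<longrightarrow> T \<le> s * (x0 N - x0 1) powr (2 * s + 1) / ((2 * s + 1) * \<gamma>))"
proof -
  have \<gamma>: "0 < \<gamma>"
    using layer_gamma_pos[OF \<open>0 < s\<close> assms(6,7)] assms(8) by simp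
  interpret alternating_charges s \<gamma> N \<zeta>
  proof
    show "\<zeta> i * \<zeta> i = 1" if "1 \<le> i" "i \<le> N" for i
      using assms(10) that by (auto dest!: bspec[of _ _ i])
    show "\<zeta> (Suc i) = - \<zeta> i" if "1 \<le> i" "i < N" for i
    proof -
      have "\<zeta> i \<in> {-1, 1}" "\<zeta> i * \<zeta> (Suc i) = - 1"
        using assms(10,11) that by (auto dest!: bspec[of _ _ i])
      then show ?thesis by auto
    qed
  qed (use assms \<gamma> in auto)
  have "x0 i < x0 j" if "1 \<le> i" "i < j" "j \<le> N" for i j
    using that(2,3)
  proof (induction j)
    case (Suc j)
    have "j \<in> {1..<N}" using Suc.prems that(1) by auto
    then have "x0 j < x0 (Suc j)" using assms(9) by auto
    with Suc show ?case by (cases "i = j") auto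
  qed simp
  then have ord: "ordered x0" by (simp add: ordered_def)
  define D where "D = (x0 N - x0 1) powr (2 * s + 1)"
  show ?thesis
  proof (cases "even N")
    case True
    \<comment> \<open>The shrinking rate for even N is \<kappa> = \<gamma> / s, which puts the
      factor s into the numerator.\<close>
    then have "\<exists>T. Tc = ereal T \<and> collision_at N x T \<and> T \<le> D / ((2 * s + 1) * (\<gamma> / s))"
      unfolding D_def using \<gamma> \<open>0 < s\<close> velocity_gap_even
      by (intro maximal_solution_finite_collision[OF assms(12) ord]) auto
    also have "D / ((2 * s + 1) * (\<gamma> / s)) = s * D / ((2 * s + 1) * \<gamma>)"
      using \<open>0 < s\<close> by simp
    finally show ?thesis using True by (auto simp: D_def)
  next
    case False
    then have *: "\<exists>T. Tc = ereal T \<and> collision_at N x T \<and> T \<le> D / ((2 * s + 1) * \<gamma>)"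
      unfolding D_def using \<gamma> velocity_gap_odd
      by (intro maximal_solution_finite_collision[OF assms(12) ord]) auto
    \<comment> \<open>For odd N the rate \<kappa> = \<gamma> gives the bound with factor 1, and N -
      1 is at least 1.\<close>
    have "1 * D \<le> (real N - 1) * D"
      using assms(5) by (intro mult_right_mono) (auto simp: D_def)
    then have "D / ((2 * s + 1) * \<gamma>) \<le> (real N - 1) * D / ((2 * s + 1) * \<gamma>)"
      using \<gamma> \<open>0 < s\<close> by (intro divide_right_mono) auto
    with * show ?thesis using False by (auto simp: D_def)
  qed
qed

end
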